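(* Let $A\in\mathbb{R}^{n\times n}$ be arbitrary, let $Q^{-1}AQ=J$ be a Jordan decomposition of $A$ ordered as in the context, and let $B\in\mathbb{C}^{n\times n}$. Then the scaled controllability Gramian $$W(B;T)=D(T)^{-1}Q^{-1}\left(\int_0^T \mathrm{e}^{At}B\,\mathrm{e}^{A^\top t}\,\mathrm{d}t\right)Q^{-*}D(T)^{-*}$$ converges as $T\to\infty$, and its limit is the block-diagonal matrix $$W_\infty(B)=\mathrm{diag}\bigl(W_-(B),\,W_0(B),\,W_+(B)\bigr).$$
   Context: Notation: $X^*$ is the conjugate transpose, $X^{-*}=(X^{-1})^*$; $\mathrm{diag}$ of square matrices is the block-diagonal matrix; $I_k$ is the identity and $N_k$ is the $k\times k$ nilpotent Jordan block with ones on the superdiagonal. Blocks of size zero are omitted. Jordan form: $Q\in\mathbb{C}^{n\times n}$ is invertible, $J=\mathrm{diag}(J_1,\dots,J_m)$, $J_i=\lambda_iI_{n_i}+N_{n_i}\in\mathbb{C}^{n_i\times n_i}$. Let $m_-,m_0,m_+$ be the numbers of Jordan blocks with $\mathrm{Re}(\lambda_i)<0$, $=0$, $>0$. The blocks are ordered so that $\mathrm{Re}(\lambda_i)<0$ for $i\le m_-$, $\mathrm{Re}(\lambda_i)=0$ for $m_-<i\le m_-+m_0$, $\mathrm{Re}(\lambda_i)>0$ for $i>m_-+m_0$, and $\mathrm{Im}(\lambda_{m_-+1})\le\cdots\le\mathrm{Im}(\lambda_{m_-+m_0})$. Let $n_-,n_0,n_+$ be the total sizes of the blocks in the three groups and $J_-,J_0,J_+$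 the corresponding diagonal blocks of $J$. Scaling: $D(T)=\mathrm{diag}(D_1(T),\dots,D_m(T))$, where $D_i(T)=I_{n_i}$ if $i\le m_-$; $D_i(T)=\mathrm{diag}(T^{n_i-1/2},T^{n_i-3/2},\dots,T^{1/2})$ if $m_-<i\le m_-+m_0$; $D_i(T)=\mathrm{e}^{J_iT}$ if $i>m_-+m_0$. Limit blocks: put $\widetilde B=Q^{-1}BQ^{-*}$, partitioned as $(\widetilde B_{i,j})_{i,j=1}^m$ with $\widetilde B_{i,j}\in\mathbb{C}^{n_i\times n_j}$, and also as $(\widetilde B_{\alpha,\beta})_{\alpha,\beta\in\{-,0,+\}}$ with $\widetilde B_{\alpha,\beta}\in\mathbb{C}^{n_\alpha\times n_\beta}$. - $W_-(B)$ and $W_+(B)$ are the unique solutions of $J_-W_-(B)+W_-(B)J_-^*+\widetilde B_{-,-}=O$ and $(-J_+)W_+(B)+W_+(B)(-J_+^* )+\widetilde B_{+,+}=O$. - For $m_-<i,j\le m_-+m_0$, let $\widetilde b_{i,j}$ be the $(n_i,n_j)$ (lower-right) entry of $\widetilde B_{i,j}$, and let $C_{i,j}\in\mathbb{R}^{n_i\times n_j}$ have $(a,b)$ entry $\frac{1}{(n_i-a)!\,(n_j-b)!\,(n_i-a+n_j-b+1)}$. - Let $\lambda_1',\dots,\lambda_{m_0'}'$ be the distinct values among $\lambda_{m_-+1},\dots,\lambda_{m_-+m_0}$, ordered by strictly increasing imaginary part, and let $m_0^{(\ell)}$ be the number of Jordan blocks with eigenvalue $\lambda_\ell'$. With $\alpha=m_-+m_0^{(1)}+\cdots+m_0^{(\ell-1)}$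 and $\beta=\alpha+m_0^{(\ell)}$, $W_0^{(\ell)}(B)$ is the block matrix $(\widetilde b_{i,j}C_{i,j})_{i,j=\alpha+1}^{\beta}$, and $W_0(B)=\mathrm{diag}(W_0^{(1)}(B),\dots,W_0^{(m_0')}(B))$. *)

theory Defs
  imports
    "HOL-Analysis.Analysis"
    "Jordan_Normal_Form.Jordan_Normal_Form"
    "Jordan_Normal_Form.Gauss_Jordan_Elimination"
    "Jordan_Normal_Form.Schur_Decomposition"
    "Jordan_Normal_Form.DL_Submatrix"
begin

text \<open>Matrices, blocks and lists of blocks are indexed from 0.\<close>

text \<open>\<^const>\<open>mat_inverse\<close> returns \<^const>\<open>None\<close> on singular matrices; the value
  of \<open>mat_inv\<close> is unspecified there.\<close>

definition mat_inv :: "'a::field mat \<Rightarrow> 'a mat" where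
  "mat_inv A = the (mat_inverse A)"

text \<open>Series, integrals and limits of matrices are taken entry by entry.\<close>

definition mat_exp :: "'a::real_normed_field mat \<Rightarrow> 'a mat" where
  "mat_exp A = Matrix.mat (dim_row A) (dim_row A)
     (\<lambda>(i, j). \<Sum>k. (A ^\<^sub>m k) $$ (i, j) / fact k)"

definition mat_integral :: "nat \<Rightarrow> nat \<Rightarrow> real set \<Rightarrow> (real \<Rightarrow> complex mat) \<Rightarrow> complex mat" where
  "mat_integral nr nc S F = Matrix.mat nr nc (\<lambda>(i, j). integral S (\<lambda>t. F t $$ (i, j)))"

definition mat_tendsto :: "(real \<Rightarrow> complex mat) \<Rightarrow> complex mat \<Rightarrow> real filter \<Rightarrow> bool" where
  "mat_tendsto F L net \<longleftrightarrow>
     (\<forall>\<^sub>F T in net. F T \<in> carrier_mat (dim_row L) (dim_col L)) \<and>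
     (\<forall>i<dim_row L. \<forall>j<dim_col L. ((\<lambda>T. F T $$ (i, j)) \<longlongrightarrow> L $$ (i, j)) net)"

text \<open>For a list \<open>ks\<close> of block sizes, block \<open>i\<close> occupies the indices from \<open>block_off ks i\<close>
  (inclusive) to \<open>block_off ks (Suc i)\<close> (exclusive), and \<open>block_of ks r\<close> is the block
  containing the index \<open>r\<close>.\<close>

definition block_off :: "nat list \<Rightarrow> nat \<Rightarrow> nat" where
  "block_off ks i = sum_list (take i ks)"

definition block_of :: "nat list \<Rightarrow> nat \<Rightarrow> nat" where
  "block_of ks r = (LEAST i. r < block_off ks (Suc i))"

definition block_mat :: "nat list \<Rightarrow> (nat \<Rightarrow> nat \<Rightarrow> 'a mat) \<Rightarrow> 'a mat" where
  "block_mat ks F = Matrix.mat (sum_list ks) (sum_list ks)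
     (\<lambda>(r, s). F (block_of ks r) (block_of ks s) $$
        (r - block_off ks (block_of ks r), s - block_off ks (block_of ks s)))"

text \<open>The list \<open>js\<close> of pairs (size, eigenvalue) describes the matrix
  \<^term>\<open>jordan_matrix js\<close>.\<close>

definition m_neg :: "(nat \<times> complex) list \<Rightarrow> nat" where
  "m_neg js = length (filter (\<lambda>(k, l). Re l < 0) js)"

definition m_zero :: "(nat \<times> complex) list \<Rightarrow> nat" where
  "m_zero js = length (filter (\<lambda>(k, l). Re l = 0) js)"

definition jordan_ordered :: "(nat \<times> complex) list \<Rightarrow> bool" where
  "jordan_ordered js \<longleftrightarrow>
     (\<forall>i<length js. 0 < fst (js ! i)) \<and>
     (\<forall>i<m_neg js. Re (snd (js ! i)) < 0) \<and>
     (\<forall>i\<in>{m_neg js..<m_neg js + m_zero js}. Re (snd (js ! i)) = 0) \<and>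
     (\<forall>i\<in>{m_neg js + m_zero js..<length js}. 0 < Re (snd (js ! i))) \<and>
     (\<forall>i\<in>{m_neg js..<m_neg js + m_zero js}. \<forall>j\<in>{m_neg js..<m_neg js + m_zero js}.
        i \<le> j \<longrightarrow> Im (snd (js ! i)) \<le> Im (snd (js ! j)))"

abbreviation j_off :: "(nat \<times> complex) list \<Rightarrow> nat \<Rightarrow> nat" where
  "j_off js \<equiv> block_off (map fst js)"

definition J_neg :: "(nat \<times> complex) list \<Rightarrow> complex mat" where
  "J_neg js = jordan_matrix (take (m_neg js) js)"

definition J_pos :: "(nat \<times> complex) list \<Rightarrow> complex mat" where
  "J_pos js = jordan_matrix (drop (m_neg js + m_zero js) js)"

definition scal_block :: "(nat \<times> complex) list \<Rightarrow> real \<Rightarrow> nat \<Rightarrow> complex mat" where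
  "scal_block js T i = (let (k, l) = js ! i in
     if i < m_neg js then 1\<^sub>m k
     else if i < m_neg js + m_zero js then
       mat_diag k (\<lambda>a. complex_of_real (T powr (real k - real a - 1/2)))
     else mat_exp (complex_of_real T \<cdot>\<^sub>m jordan_block k l))"

definition scal_mat :: "(nat \<times> complex) list \<Rightarrow> real \<Rightarrow> complex mat" where
  "scal_mat js T = diag_block_mat (map (scal_block js T) [0..<length js])"

definition gramian :: "complex mat \<Rightarrow> complex mat \<Rightarrow> real \<Rightarrow> complex mat" where
  "gramian A B T = mat_integral (dim_row A) (dim_row A) {0..T}
     (\<lambda>t. mat_exp (complex_of_real t \<cdot>\<^sub>m A) * B *
          mat_exp (complex_of_real t \<cdot>\<^sub>m transpose_mat A))"

definition scaled_gramian ::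
  "complex mat \<Rightarrow> complex mat \<Rightarrow> (nat \<times> complex) list \<Rightarrow> complex mat \<Rightarrow> real \<Rightarrow> complex mat" where
  "scaled_gramian A Q js B T =
     mat_inv (scal_mat js T) * mat_inv Q * gramian A B T *
     mat_adjoint (mat_inv Q) * mat_adjoint (mat_inv (scal_mat js T))"

definition B_tilde :: "complex mat \<Rightarrow> complex mat \<Rightarrow> complex mat" where
  "B_tilde Q B = mat_inv Q * B * mat_adjoint (mat_inv Q)"

definition lyap_solution :: "complex mat \<Rightarrow> complex mat \<Rightarrow> complex mat" where
  "lyap_solution F G = (THE X. X \<in> carrier_mat (dim_row F) (dim_row F) \<and>
     F * X + X * mat_adjoint F + G = 0\<^sub>m (dim_row F) (dim_row F))"

definition W_neg :: "complex mat \<Rightarrow> (nat \<times> complex) list \<Rightarrow> complex mat \<Rightarrow> complex mat" where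
  "W_neg Q js B = (let I = {0..<j_off js (m_neg js)} in
     lyap_solution (J_neg js) (submatrix (B_tilde Q B) I I))"

definition W_pos :: "complex mat \<Rightarrow> (nat \<times> complex) list \<Rightarrow> complex mat \<Rightarrow> complex mat" where
  "W_pos Q js B =
     (let I = {j_off js (m_neg js + m_zero js)..<j_off js (length js)} in
     lyap_solution (- J_pos js) (submatrix (B_tilde Q B) I I))"

definition b_tilde ::
  "complex mat \<Rightarrow> (nat \<times> complex) list \<Rightarrow> complex mat \<Rightarrow> nat \<Rightarrow> nat \<Rightarrow> complex" where
  "b_tilde Q js B i j =
     submatrix (B_tilde Q B) {j_off js i..<j_off js (Suc i)} {j_off js j..<j_off js (Suc j)} $$
       (fst (js ! i) - 1, fst (js ! j) - 1)"

text \<open>With indices counted from 1, the entry at \<open>(a, b)\<close> is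
  \<open>1 / ((p - a)! (q - b)! (p - a + q - b + 1))\<close>.\<close>

definition C_mat :: "nat \<Rightarrow> nat \<Rightarrow> real mat" where
  "C_mat p q = Matrix.mat p q (\<lambda>(a, b).
     1 / (fact (p - Suc a) * fact (q - Suc b) * real ((p - Suc a) + (q - Suc b) + 1)))"

definition imag_eigenvalues :: "(nat \<times> complex) list \<Rightarrow> complex list" where
  "imag_eigenvalues js = sorted_key_list_of_set Im
     ((\<lambda>i. snd (js ! i)) ` {m_neg js..<m_neg js + m_zero js})"

definition eig_count :: "(nat \<times> complex) list \<Rightarrow> nat \<Rightarrow> nat" where
  "eig_count js l = length (filter (\<lambda>p. snd p = imag_eigenvalues js ! l) js)"

definition W_zero_block ::
  "complex mat \<Rightarrow> (nat \<times> complex) list \<Rightarrow> complex mat \<Rightarrow> nat \<Rightarrow> complex mat" where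
  "W_zero_block Q js B l =
     (let \<alpha> = m_neg js + (\<Sum>k<l. eig_count js k); \<beta> = \<alpha> + eig_count js l in
      block_mat (map (\<lambda>i. fst (js ! i)) [\<alpha>..<\<beta>])
        (\<lambda>i j. b_tilde Q js B (\<alpha> + i) (\<alpha> + j) \<cdot>\<^sub>m
           map_mat complex_of_real (C_mat (fst (js ! (\<alpha> + i))) (fst (js ! (\<alpha> + j))))))"

definition W_zero :: "complex mat \<Rightarrow> (nat \<times> complex) list \<Rightarrow> complex mat \<Rightarrow> complex mat" where
  "W_zero Q js B =
     diag_block_mat (map (W_zero_block Q js B) [0..<length (imag_eigenvalues js)])"

definition W_infinity :: "complex mat \<Rightarrow> (nat \<times> complex) list \<Rightarrow> complex mat \<Rightarrow> complex mat" where
  "W_infinity Q js B = diag_block_mat [W_neg Q js B, W_zero Q js B, W_pos Q js B]"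

end

theory Submission
  imports Defs
begin

text \<open>
  In Jordan coordinates the integrand is \<open>exp (J t) B~ exp (J t)\<^sup>*\<close>, and the scaling can be moved
  under the integral: \<open>D(T)\<^sup>-\<^sup>1 exp (J t)\<close> is block diagonal with entries of size
  \<open>exp (\<lambda> t) t\<^sup>d\<close> for \<open>Re \<lambda> < 0\<close>, of the same form at time \<open>t - T\<close> for \<open>Re \<lambda> > 0\<close>, and
  \<open>O(T powr - 1/2)\<close> on \<open>[0, T]\<close> for \<open>Re \<lambda> = 0\<close>. So the limit reduces to scalar integrals of products
  of two such entries. If the signs of the real parts differ, the products are small either
  pointwise or in the mean; for two imaginary eigenvalues the mean of \<open>t\<^sup>m exp (i \<omega> t)\<close> vanishes
  in the limit when \<open>\<omega> \<noteq> 0\<close>, and for \<open>\<omega> = 0\<close> only the highest power of \<open>t\<close> survives, which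
  occurs in the last columns of both blocks. The stable and the antistable diagonal blocks
  converge to improper integrals that solve Lyapunov equations; the substitution
  \<open>t \<mapsto> T - t\<close> turns the antistable one into a stable one for \<open>- J\<^sub>+\<close>.
\<close>

section \<open>Exponential moments\<close>

text \<open>The powers in the scaling are forced by one count. In a row of an imaginary block with
  \<open>p\<close> rows below it, the highest power of \<open>t\<close> is \<open>p\<close>; for two
  such rows the integrals over \<open>[0, T]\<close> grow at most like
  \<open>T ^ (p + q + 1)\<close>, which is exactly what the factors
  \<open>T powr (- p - 1/2)\<close> and \<open>T powr (- q - 1/2)\<close> remove. The number
  \<open>p + q + 1\<close> in the denominator of \<open>C_mat\<close> comes from integrating
  \<open>t ^ (p + q)\<close>.

  The improper integrals of the stable and antistable sections are never evaluated: existence of the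
  limit is enough, since a Lyapunov equation identifies it. Uniqueness has to be proved together
  with existence, because \<open>lyap_solution\<close> is a definite description.

  The other obstacle is bookkeeping. The scaling and the limit choose their cases by block position
  and by counting eigenvalues, while the estimates depend on the eigenvalues alone; the ordering of
  the Jordan blocks has to translate one into the other.\<close>

definition exp_moment :: "complex \<Rightarrow> nat \<Rightarrow> real \<Rightarrow> complex" where
  "exp_moment c m T = integral {0..T} (\<lambda>t. of_real t ^ m * exp (c * of_real t))"

text \<open>The product rule, kept uncancelled so that one formula serves three purposes:
  \<open>m = 0\<close> starts the recursion for the moments, \<open>m > 0\<close> is its integration
  by parts, and \<open>c = 0\<close> is the power rule. For \<open>m = 0\<close> the truncated
  exponent \<open>m - 1\<close> is harmless because its coefficient is 0, and the boundary term
  \<open>0 ^ m\<close> is 1.\<close>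

lemma has_integral_deriv_exp_moment:
  fixes c :: complex
  assumes "0 \<le> T"
  shows "((\<lambda>t. of_nat m * of_real t ^ (m - 1) * exp (c * of_real t)
            + c * (of_real t ^ m * exp (c * of_real t)))
          has_integral (of_real T ^ m * exp (c * of_real T) - 0 ^ m)) {0..T}"
proof -
  have "((\<lambda>t. of_real t ^ m * exp (c * of_real t)) has_vector_derivative
       of_nat m * of_real t ^ (m - 1) * exp (c * of_real t) + c * (of_real t ^ m * exp (c * of_real t)))
       (at t within {0..T})" for t
    by (rule has_vector_derivative_real_field[where f = "\<lambda>z::complex. z ^ m * exp (c * z)"])
      (auto intro!: derivative_eq_intros)
  from fundamental_theorem_of_calculus[OF assms this] show ?thesis
    by simp
qed

lemma exp_moment_0:
  assumes "0 \<le> T" "c \<noteq> 0"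
  shows "exp_moment c 0 T = (exp (c * of_real T) - 1) / c"
proof -
  have "((\<lambda>t. inverse c * (c * exp (c * of_real t))) has_integral
      inverse c * (exp (c * of_real T) - 1)) {0..T}"
    using has_integral_mult_right[OF has_integral_deriv_exp_moment[OF assms(1), of 0 c], of "inverse c"]
    by simp
  then have "((\<lambda>t. exp (c * of_real t)) has_integral inverse c * (exp (c * of_real T) - 1)) {0..T}"
    using assms(2) by (simp add: mult.assoc[symmetric])
  then show ?thesis
    unfolding exp_moment_def by (simp add: integral_unique field_simps)
qed

text \<open>Integration by parts; both the convergence and the growth of the moments follow from it
  by induction on \<open>m\<close>.\<close>

lemma exp_moment_Suc:
  assumes "0 \<le> T" "c \<noteq> 0"
  shows "exp_moment c (Suc m) T =
    (of_real T ^ Suc m * exp (c * of_real T) - of_nat (Suc m) * exp_moment c m T) / c"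
proof -
  let ?f = "\<lambda>m t. of_real t ^ m * exp (c * of_real t)"
  have int: "?f m integrable_on {0..T}" for m
    by (intro integrable_continuous_real continuous_intros)
  have "integral {0..T} (\<lambda>t. of_nat (Suc m) * ?f m t + c * ?f (Suc m) t)
      = of_nat (Suc m) * exp_moment c m T + c * exp_moment c (Suc m) T"
    unfolding exp_moment_def
    by (subst integral_add[OF integrable_on_mult_right[OF int] integrable_on_mult_right[OF int]])
      (simp only: integral_mult_right)
  moreover have "integral {0..T} (\<lambda>t. of_nat (Suc m) * ?f m t + c * ?f (Suc m) t)
      = of_real T ^ Suc m * exp (c * of_real T)"
    using integral_unique[OF has_integral_deriv_exp_moment[OF assms(1), of "Suc m" c]]
    by (simp add: mult.assoc)
  ultimately show ?thesis
    using assms(2) by (simp add: field_simps)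
qed

lemma tendsto_power_mult_exp_neg:
  fixes a :: real
  assumes "0 < a"
  shows "((\<lambda>T. T ^ m * exp (- (a * T))) \<longlongrightarrow> 0) at_top"
proof -
  have "filterlim (\<lambda>T. a * T) at_top at_top"
    by (rule filterlim_tendsto_pos_mult_at_top[OF tendsto_const assms filterlim_ident])
  from filterlim_compose[OF tendsto_power_div_exp_0 this, of m]
  have "((\<lambda>T. inverse (a ^ m) * ((a * T) ^ m / exp (a * T))) \<longlongrightarrow> inverse (a ^ m) * 0) at_top"
    by (intro tendsto_intros)
  then show ?thesis
    using assms by (simp add: power_mult_distrib exp_minus field_simps)
qed

lemma tendsto_power_mult_exp_complex:
  assumes "Re c < 0"
  shows "((\<lambda>T. of_real T ^ m * exp (c * of_real T)) \<longlongrightarrow> 0) at_top"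
proof (rule Lim_null_comparison)
  show "((\<lambda>T. \<bar>T ^ m * exp (- (- Re c * T))\<bar>) \<longlongrightarrow> 0) at_top"
    using tendsto_rabs[OF tendsto_power_mult_exp_neg[of "- Re c" m]] assms by simp
qed (simp add: norm_mult norm_power abs_mult power_abs)

text \<open>The boundary term of the recursion decays, so convergence passes from \<open>m\<close>
  to \<open>Suc m\<close>.\<close>

lemma exp_moment_convergent:
  assumes "Re c < 0"
  shows "\<exists>L. (exp_moment c m \<longlongrightarrow> L) at_top"
proof (induction m)
  from assms have c: "c \<noteq> 0" by auto
  case 0
  have "((\<lambda>T. (of_real T ^ 0 * exp (c * of_real T) - 1) / c) \<longlongrightarrow> (0 - 1) / c) at_top"
    by (intro tendsto_intros tendsto_power_mult_exp_complex assms c)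
  moreover have "\<forall>\<^sub>F T in at_top. (of_real T ^ 0 * exp (c * of_real T) - 1) / c = exp_moment c 0 T"
    using eventually_ge_at_top[of 0] by eventually_elim (simp add: exp_moment_0 c)
  ultimately show ?case
    using Lim_transform_eventually by blast
next
  from assms have c: "c \<noteq> 0" by auto
  case (Suc m)
  then obtain L where L: "(exp_moment c m \<longlongrightarrow> L) at_top" by blast
  have "((\<lambda>T. (of_real T ^ Suc m * exp (c * of_real T) - of_nat (Suc m) * exp_moment c m T) / c)
      \<longlongrightarrow> (0 - of_nat (Suc m) * L) / c) at_top"
    by (intro tendsto_intros tendsto_power_mult_exp_complex assms c L)
  moreover have "\<forall>\<^sub>F T in at_top. (of_real T ^ Suc m * exp (c * of_real T)
      - of_nat (Suc m) * exp_moment c m T) / c = exp_moment c (Suc m) T"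
    using eventually_ge_at_top[of 0] by eventually_elim (simp only: exp_moment_Suc c not_False_eq_True)
  ultimately show ?case
    using Lim_transform_eventually by blast
qed

text \<open>Oscillation saves one power of \<open>T\<close> against the trivial bound
  \<open>T ^ Suc m\<close>: the boundary term has size \<open>T ^ m\<close>, and dividing by
  \<open>c\<close> costs only a constant. For \<open>T\<close> at least 1 lower powers are absorbed
  by higher ones.\<close>

lemma exp_moment_bound:
  assumes "Re c \<le> 0" "c \<noteq> 0"
  shows "\<exists>K\<ge>0. \<forall>T\<ge>1. norm (exp_moment c m T) \<le> K * T ^ m"
proof (induction m)
  case 0
  have "norm (exp_moment c 0 T) \<le> 2 / norm c" if "1 \<le> T" for T
  proof -
    have "norm (exp (c * of_real T) - 1) \<le> exp (Re c * T) + 1"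
      using norm_triangle_ineq4[of "exp (c * of_real T)" 1] by simp
    also have "exp (Re c * T) \<le> 1"
      using assms(1) that by (simp add: mult_nonpos_nonneg)
    finally show ?thesis
      using that assms(2) by (simp add: exp_moment_0 norm_divide divide_right_mono)
  qed
  then show ?case
    by (intro exI[of _ "2 / norm c"]) auto
next
  case (Suc m)
  then obtain K where K: "0 \<le> K" "\<And>T. 1 \<le> T \<Longrightarrow> norm (exp_moment c m T) \<le> K * T ^ m"
    by blast
  have "norm (exp_moment c (Suc m) T) \<le> (1 + real (Suc m) * K) / norm c * T ^ Suc m"
    if T: "1 \<le> T" for T
  proof -
    have e: "exp (Re c * T) \<le> 1"
      using assms(1) that by (simp add: mult_nonpos_nonneg)
    have "norm (of_real T ^ Suc m * exp (c * of_real T) - of_nat (Suc m) * exp_moment c m T)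
        \<le> norm (of_real T ^ Suc m * exp (c * of_real T)) + norm (of_nat (Suc m) * exp_moment c m T)"
      by (rule norm_triangle_ineq4)
    also have "\<dots> = T ^ Suc m * exp (Re c * T) + real (Suc m) * norm (exp_moment c m T)"
      using T by (simp add: norm_mult norm_power del: of_nat_Suc)
    also have "\<dots> \<le> T ^ Suc m * 1 + real (Suc m) * (K * T ^ Suc m)"
    proof (intro add_mono mult_left_mono e)
      have "K * T ^ m \<le> K * T ^ Suc m"
        using T K by (intro mult_left_mono power_increasing) auto
      then show "norm (exp_moment c m T) \<le> K * T ^ Suc m"
        using K(2)[OF T] by linarith
    qed (use T in auto)
    also have "\<dots> = (1 + real (Suc m) * K) * T ^ Suc m"
      by (simp add: algebra_simps)
    finally have "norm (exp_moment c (Suc m) T) \<le> (1 + real (Suc m) * K) * T ^ Suc m / norm c"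
      using T assms(2)
      by (simp add: exp_moment_Suc norm_divide divide_right_mono del: power_Suc of_nat_Suc)
    then show ?thesis by simp
  qed
  then show ?case
    using K(1) by (intro exI[of _ "(1 + real (Suc m) * K) / norm c"] conjI) auto
qed

section \<open>Entries of the scaled exponential\<close>

text \<open>The entry \<open>d\<close> places to the right of the diagonal in the exponential of a
  Jordan block with eigenvalue \<open>l\<close>; negative times occur as well.\<close>

definition jexp :: "complex \<Rightarrow> nat \<Rightarrow> real \<Rightarrow> complex" where
  "jexp l d t = exp (l * of_real t) * of_real t ^ d / fact d"

text \<open>The entry of \<open>D\<^sub>i(T)\<^sup>-\<^sup>1 exp (J\<^sub>i t)\<close> in a column \<open>d\<close> places to the right of the
  diagonal and in the row that has \<open>p\<close> rows of the block below it.\<close>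

definition kern :: "complex \<Rightarrow> nat \<Rightarrow> nat \<Rightarrow> real \<Rightarrow> real \<Rightarrow> complex" where
  "kern l p d T t =
     (if Re l < 0 then jexp l d t
      else if Re l = 0 then of_real (T powr (- real p - 1/2)) * jexp l d t
      else jexp l d (t - T))"

lemma continuous_on_jexp [continuous_intros]:
  "continuous_on S f \<Longrightarrow> continuous_on S (\<lambda>t. jexp l d (f t))"
  unfolding jexp_def by (intro continuous_intros) auto

lemma continuous_on_kern [continuous_intros]: "continuous_on S (kern l p d T)"
  by (cases "Re l < 0"; cases "Re l = 0") (auto simp: kern_def[abs_def] intro!: continuous_intros)

lemma integrable_kern_mult:
  "(\<lambda>t. kern l p d T t * cnj (kern m q e T t)) integrable_on {a..b}"
  by (intro integrable_continuous_real continuous_intros)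

lemma norm_jexp: "norm (jexp l d t) = exp (Re l * t) * \<bar>t\<bar> ^ d / fact d"
  by (simp only: jexp_def norm_mult norm_divide norm_power norm_exp_eq_Re norm_of_real norm_fact) simp

lemma jexp_uminus: "jexp l d (- t) = (- 1) ^ d * jexp (- l) d t"
  by (simp add: jexp_def power_minus[of "complex_of_real t"])

text \<open>The exponents combine to \<open>l + cnj m\<close>, so the product of two entries is a
  single moment integrand. For imaginary eigenvalues this exponent is the difference
  \<open>l - m\<close>.\<close>

lemma jexp_mult:
  "jexp l d t * cnj (jexp m e t)
   = of_real t ^ (d + e) * exp ((l + cnj m) * of_real t) / (fact d * fact e)"
  by (simp add: jexp_def exp_cnj exp_add algebra_simps power_add)

lemma integral_jexp_mult:
  "integral {0..T} (\<lambda>t. jexp l d t * cnj (jexp m e t))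
   = exp_moment (l + cnj m) (d + e) T / (fact d * fact e)"
  unfolding jexp_mult exp_moment_def by (rule integral_divide)

text \<open>Needed for antistable blocks: their kernel depends on \<open>t - T\<close>, and after
  the reflection \<open>T\<close> appears only as the upper limit of integration.\<close>

lemma integral_reflect_interval:
  fixes f :: "real \<Rightarrow> 'a::euclidean_space"
  shows "integral {0..T} (\<lambda>t. f (t - T)) = integral {0..T} (\<lambda>t. f (- t))"
proof -
  have "integral {0..T} (\<lambda>t. f (t - T)) = integral {0 - T..T - T} f"
    using integral_shift_real_ivl[of 0 T T "\<lambda>t. f (t - T)"] by simp
  also have "\<dots> = integral {0..T} (\<lambda>t. f (- t))"
    using Henstock_Kurzweil_Integration.integral_reflect_real[of T 0 "\<lambda>t. f (- t)"]
    by (simp only: minus_minus minus_zero diff_0 diff_self)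
  finally show ?thesis .
qed

text \<open>The sign \<open>s\<close> treats stable blocks at time \<open>t\<close> and antistable
  blocks at time \<open>- t\<close> together: in both cases the combined exponent has negative real
  part.\<close>

lemma jexp_integral_convergent:
  fixes s :: real
  assumes "s = 1 \<or> s = - 1" "s * Re l < 0" "s * Re m < 0"
  shows "\<exists>L. ((\<lambda>T. integral {0..T} (\<lambda>t. jexp l d (s * t) * cnj (jexp m e (s * t)))) \<longlongrightarrow> L) at_top"
proof -
  have eq: "jexp l d (s * t) = of_real s ^ d * jexp (of_real s * l) d t" for l d t
    using assms(1) jexp_uminus by auto
  have "Re (of_real s * l + cnj (of_real s * m)) < 0"
    using assms by auto
  then obtain L where L: "(exp_moment (of_real s * l + cnj (of_real s * m)) (d + e) \<longlongrightarrow> L) at_top"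
    using exp_moment_convergent by blast
  have "integral {0..T} (\<lambda>t. jexp l d (s * t) * cnj (jexp m e (s * t))) = of_real s ^ (d + e) *
      (exp_moment (of_real s * l + cnj (of_real s * m)) (d + e) T / (fact d * fact e))" for T
  proof -
    have "(\<lambda>t. jexp l d (s * t) * cnj (jexp m e (s * t))) = (\<lambda>t. of_real s ^ (d + e) *
        (jexp (of_real s * l) d t * cnj (jexp (of_real s * m) e t)))"
      unfolding eq by (intro ext) (simp add: power_add)
    then show ?thesis
      by (simp only: integral_mult_right integral_jexp_mult)
  qed
  then show ?thesis
    using tendsto_mult_left[OF tendsto_divide[OF L tendsto_const[of "fact d * fact e"]], of "of_real s ^ (d + e)"]
    by (intro exI) simp
qed

text \<open>On nonnegative times the norm is again a monomial times an exponential, now with the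
  real exponent \<open>Re l\<close>, so its integral is the real part of a convergent moment up to a
  factorial.\<close>

lemma integral_norm_jexp_convergent:
  assumes "Re l < 0"
  shows "\<exists>L. ((\<lambda>T. integral {0..T} (\<lambda>t. norm (jexp l d t))) \<longlongrightarrow> L) at_top"
proof -
  obtain L where L: "(exp_moment (of_real (Re l)) d \<longlongrightarrow> L) at_top"
    using exp_moment_convergent[of "of_real (Re l)"] assms by auto
  have "\<forall>\<^sub>F T in at_top. Re (exp_moment (of_real (Re l)) d T) / fact d
      = integral {0..T} (\<lambda>t. norm (jexp l d t))"
    using eventually_ge_at_top[of 0]
  proof eventually_elim
    case (elim T)
    let ?f = "\<lambda>t::real. complex_of_real t ^ d * exp (of_real (Re l) * of_real t)"
    have "?f integrable_on {0..T}"
      by (intro integrable_continuous_real continuous_intros)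
    then have "((\<lambda>t. Re (?f t)) has_integral Re (exp_moment (of_real (Re l)) d T)) {0..T}"
      unfolding exp_moment_def by (intro has_integral_Re integrable_integral)
    then have "((\<lambda>t. Re (?f t) / fact d) has_integral Re (exp_moment (of_real (Re l)) d T) / fact d) {0..T}"
      by (rule has_integral_divide)
    moreover have "Re (?f t) / fact d = norm (jexp l d t)" if "t \<in> {0..T}" for t
    proof -
      have "?f t = of_real (t ^ d * exp (Re l * t))"
        by (simp add: exp_of_real[symmetric])
      then show ?thesis
        using that by (simp only: Re_complex_of_real) (simp add: norm_jexp)
    qed
    ultimately have "((\<lambda>t. norm (jexp l d t)) has_integral
        Re (exp_moment (of_real (Re l)) d T) / fact d) {0..T}"
      by (rule has_integral_eq[rotated])
    then show ?case by (rule integral_unique[symmetric])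
  qed
  moreover have "((\<lambda>T. Re (exp_moment (of_real (Re l)) d T) / fact d) \<longlongrightarrow> Re L / fact d) at_top"
    by (intro tendsto_intros L) auto
  ultimately show ?thesis
    by (intro exI) (rule Lim_transform_eventually[rotated])
qed

text \<open>This bounds hyperbolic entries in the L1 norm for large \<open>T\<close>, to be paired
  with a sup bound on imaginary entries. For \<open>Re l > 0\<close> the reflection leads to the
  stable eigenvalue \<open>- l\<close>.\<close>

lemma integral_norm_kern_convergent:
  assumes "Re l \<noteq> 0"
  shows "\<exists>L. ((\<lambda>T. integral {0..T} (\<lambda>t. norm (kern l p d T t))) \<longlongrightarrow> L) at_top"
proof (cases "Re l < 0")
  case True
  then show ?thesis
    using integral_norm_jexp_convergent[of l d] by (simp add: kern_def)
next
  case False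
  then have l: "Re (- l) < 0" "\<not> Re l < 0" "Re l \<noteq> 0" using assms by auto
  have "integral {0..T} (\<lambda>t. norm (jexp l d (t - T)))
      = integral {0..T} (\<lambda>t. norm (jexp (- l) d t))" for T
    by (subst integral_reflect_interval) (simp add: jexp_uminus norm_mult norm_power)
  then show ?thesis
    using integral_norm_jexp_convergent[OF l(1), of d] l by (simp add: kern_def)
qed

section \<open>Limits of integrals of products of two scaled entries\<close>

lemma norm_kern_imaginary:
  assumes "Re l = 0" "d \<le> p" "1 \<le> T" "t \<in> {0..T}"
  shows "norm (kern l p d T t) \<le> T powr (- 1/2)"
proof -
  have "t ^ d \<le> T ^ p"
    using assms by (meson atLeastAtMost_iff order.trans power_increasing power_mono)
  moreover have "t ^ d / fact d \<le> t ^ d"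
    using assms by (simp add: divide_le_eq fact_ge_1 mult_le_cancel_left1)
  ultimately have "t ^ d / fact d \<le> T powr real p"
    using assms by (simp add: powr_realpow)
  then have "T powr (- real p - 1/2) * (t ^ d / fact d) \<le> T powr (- real p - 1/2) * T powr real p"
    by (intro mult_left_mono) auto
  also have "\<dots> = T powr (- 1/2)"
    by (simp add: powr_add[symmetric])
  finally show ?thesis
    using assms by (simp add: kern_def norm_mult norm_jexp)
qed

text \<open>L1 norm times sup norm: the first converges, the second is at most
  \<open>T powr (- 1/2)\<close>.\<close>

lemma kern_limit_hyperbolic_imaginary:
  assumes "Re l \<noteq> 0" "Re m = 0" "e \<le> q"
  shows "((\<lambda>T. integral {0..T} (\<lambda>t. kern l p d T t * cnj (kern m q e T t))) \<longlongrightarrow> 0) at_top"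
proof -
  obtain L where L: "((\<lambda>T. integral {0..T} (\<lambda>t. norm (kern l p d T t))) \<longlongrightarrow> L) at_top"
    using integral_norm_kern_convergent[OF assms(1)] by blast
  have "((\<lambda>T::real. T powr (- 1/2)) \<longlongrightarrow> 0) at_top"
    by (rule tendsto_neg_powr) (auto simp: filterlim_ident)
  from tendsto_mult[OF L this]
  have lim: "((\<lambda>T. integral {0..T} (\<lambda>t. norm (kern l p d T t)) * T powr (- 1/2)) \<longlongrightarrow> 0) at_top"
    by simp
  show ?thesis
  proof (rule Lim_null_comparison[OF _ lim])
    show "\<forall>\<^sub>F T in at_top. norm (integral {0..T} (\<lambda>t. kern l p d T t * cnj (kern m q e T t)))
        \<le> integral {0..T} (\<lambda>t. norm (kern l p d T t)) * T powr (- 1/2)"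
      using eventually_ge_at_top[of 1]
    proof eventually_elim
      case (elim T)
      have "norm (integral {0..T} (\<lambda>t. kern l p d T t * cnj (kern m q e T t)))
          \<le> integral {0..T} (\<lambda>t. norm (kern l p d T t) * T powr (- 1/2))"
      proof (rule integral_norm_bound_integral)
        show "(\<lambda>t. norm (kern l p d T t) * T powr (- 1/2)) integrable_on {0..T}"
          by (intro integrable_continuous_real continuous_intros)
        show "norm (kern l p d T t * cnj (kern m q e T t)) \<le> norm (kern l p d T t) * T powr (- 1/2)"
          if "t \<in> {0..T}" for t
          using norm_kern_imaginary[OF assms(2,3) elim that]
          by (simp add: norm_mult mult_left_mono)
      qed (rule integrable_kern_mult)
      then show ?case by simp
    qed
  qed
qed

text \<open>One factor is concentrated near \<open>t = 0\<close>, the other near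
  \<open>t = T\<close>. Their product is exponentially small uniformly on the interval; the powers
  of \<open>t\<close> and the length of the interval contribute only the polynomial factor.\<close>

lemma kern_limit_neg_pos:
  assumes "Re l < 0" "0 < Re m"
  shows "((\<lambda>T. integral {0..T} (\<lambda>t. kern l p d T t * cnj (kern m q e T t))) \<longlongrightarrow> 0) at_top"
proof -
  \<comment> \<open>The slower of the two decay rates, to which both exponents are compared.\<close>
  define g where "g = min (- Re l) (Re m)"
  have g: "0 < g" "g \<le> - Re l" "g \<le> Re m" using assms by (auto simp: g_def)
  show ?thesis
  proof (rule Lim_null_comparison[OF _ tendsto_power_mult_exp_neg[OF g(1), of "Suc (d + e)"]])
    show "\<forall>\<^sub>F T in at_top. norm (integral {0..T} (\<lambda>t. kern l p d T t * cnj (kern m q e T t)))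
        \<le> T ^ Suc (d + e) * exp (- (g * T))"
      using eventually_ge_at_top[of 1]
    proof eventually_elim
      case (elim T)
      have "norm (integral {0..T} (\<lambda>t. kern l p d T t * cnj (kern m q e T t)))
          \<le> integral {0..T} (\<lambda>t. T ^ (d + e) * exp (- (g * T)))"
      proof (rule integral_norm_bound_integral)
        fix t assume t: "t \<in> {0..T}"
        have 1: "t ^ d / fact d \<le> T ^ d"
        proof -
          have "t ^ d / fact d \<le> t ^ d"
            using t by (simp add: divide_le_eq fact_ge_1 mult_le_cancel_left1)
          also have "\<dots> \<le> T ^ d" using t by (simp add: power_mono)
          finally show ?thesis .
        qed
        have 2: "(T - t) ^ e / fact e \<le> T ^ e"
        proof -
          have "(T - t) ^ e / fact e \<le> (T - t) ^ e"
            using t by (simp add: divide_le_eq fact_ge_1 mult_le_cancel_left1)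
          also have "\<dots> \<le> T ^ e" using t by (simp add: power_mono)
          finally show ?thesis .
        qed
        have 3: "exp (Re l * t) * exp (Re m * (t - T)) \<le> exp (- (g * T))"
        proof -
          \<comment> \<open>The two exponents add up to \<open>- (g * T)\<close>, independently of
            \<open>t\<close>. The second inequality uses \<open>t - T \<le> 0\<close>, which
            reverses the comparison of the rates.\<close>
          have "Re l * t \<le> - g * t" using g t by (intro mult_right_mono) auto
          moreover have "Re m * (t - T) \<le> g * (t - T)" using g t by (intro mult_right_mono_neg) auto
          ultimately have "Re l * t + Re m * (t - T) \<le> - (g * T)"
            by (simp add: algebra_simps)
          then show ?thesis by (simp flip: exp_add)
        qed
        have "norm (kern l p d T t * cnj (kern m q e T t))
            = ((t ^ d / fact d) * ((T - t) ^ e / fact e)) * (exp (Re l * t) * exp (Re m * (t - T)))"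
          using assms t by (simp add: kern_def norm_mult norm_jexp abs_minus_commute[of t T])
        also have "\<dots> \<le> (T ^ d * T ^ e) * exp (- (g * T))"
          using t elim by (intro mult_mono 1 2 3) auto
        finally show "norm (kern l p d T t * cnj (kern m q e T t)) \<le> T ^ (d + e) * exp (- (g * T))"
          by (simp add: power_add)
      qed (auto intro: integrable_kern_mult)
      then show ?case using elim by (simp add: mult_ac)
    qed
  qed
qed

text \<open>For imaginary numbers \<open>l + cnj m\<close> vanishes only if they coincide. Otherwise
  the moment is one power of \<open>T\<close> smaller than the scaling allows for, which leaves
  \<open>K / T\<close>.\<close>

lemma kern_limit_imaginary_distinct:
  assumes "Re l = 0" "Re m = 0" "l \<noteq> m" "d \<le> p" "e \<le> q"
  shows "((\<lambda>T. integral {0..T} (\<lambda>t. kern l p d T t * cnj (kern m q e T t))) \<longlongrightarrow> 0) at_top"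
proof -
  have "Re (l + cnj m) \<le> 0" "l + cnj m \<noteq> 0"
    using assms by (auto simp: complex_eq_iff)
  then obtain K where K: "0 \<le> K" "\<And>T. 1 \<le> T \<Longrightarrow> norm (exp_moment (l + cnj m) (d + e) T) \<le> K * T ^ (d + e)"
    using exp_moment_bound by metis
  have lim: "((\<lambda>T. K * inverse T) \<longlongrightarrow> 0) at_top"
    using tendsto_mult_left[OF tendsto_inverse_0_at_top[OF filterlim_ident], of K] by simp
  show ?thesis
  proof (rule Lim_null_comparison[OF _ lim])
    show "\<forall>\<^sub>F T in at_top. norm (integral {0..T} (\<lambda>t. kern l p d T t * cnj (kern m q e T t)))
        \<le> K * inverse T"
      using eventually_ge_at_top[of 1]
    proof eventually_elim
      case (elim T)
      let ?s = "T powr (- real p - 1/2) * T powr (- real q - 1/2)"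
      have "integral {0..T} (\<lambda>t. kern l p d T t * cnj (kern m q e T t))
          = integral {0..T} (\<lambda>t. of_real ?s * (jexp l d t * cnj (jexp m e t)))"
        using assms by (simp add: kern_def mult_ac)
      also have "\<dots> = of_real ?s * (exp_moment (l + cnj m) (d + e) T / (fact d * fact e))"
        by (simp only: integral_mult_right integral_jexp_mult)
      also have "norm \<dots> = ?s * (norm (exp_moment (l + cnj m) (d + e) T) / (fact d * fact e))"
        by (simp add: norm_mult norm_divide)
      also have "\<dots> \<le> ?s * (K * T ^ (d + e))"
      proof (intro mult_left_mono)
        have "1 \<le> (fact d * fact e :: real)"
          using mult_mono[of 1 "fact d :: real" 1 "fact e"] by (simp add: fact_ge_1)
        then have "norm (exp_moment (l + cnj m) (d + e) T) / (fact d * fact e)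
            \<le> norm (exp_moment (l + cnj m) (d + e) T) / 1"
          by (intro divide_left_mono) auto
        also have "\<dots> \<le> K * T ^ (d + e)" using K(2)[OF elim] by simp
        finally show "norm (exp_moment (l + cnj m) (d + e) T) / (fact d * fact e) \<le> K * T ^ (d + e)" .
      qed simp
      also have "\<dots> \<le> ?s * (K * T ^ (p + q))"
        using assms K elim by (intro mult_left_mono power_increasing) auto
      also have "\<dots> = K * inverse T"
      proof -
        have "T ^ (p + q) = T powr (real p + real q)"
          using elim by (simp add: powr_realpow[symmetric])
        then have "?s * T ^ (p + q) = T powr (- 1)"
          by (simp add: powr_add[symmetric])
        also have "\<dots> = inverse T" using elim by (simp add: powr_minus)
        finally show ?thesis by simp
      qed
      finally show ?case .
    qed
  qed
qed

text \<open>The frequencies cancel in \<open>l + cnj l = 0\<close>, so the integral is a pure power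
  of \<open>T\<close>. After scaling its exponent is \<open>- ((p - d) + (q - e))\<close>, which is
  zero exactly for \<open>d = p\<close> and \<open>e = q\<close>.\<close>

lemma kern_limit_imaginary_same:
  assumes "Re l = 0" "d \<le> p" "e \<le> q"
  shows "((\<lambda>T. integral {0..T} (\<lambda>t. kern l p d T t * cnj (kern l q e T t))) \<longlongrightarrow>
     (if d = p \<and> e = q then 1 / (fact p * fact q * of_nat (p + q + 1)) else 0)) at_top"
proof -
  have l: "l + cnj l = 0" using assms by (simp add: complex_eq_iff)
  define C :: real where "C = 1 / (fact d * fact e * real (d + e + 1))"
  have ev: "\<forall>\<^sub>F T in at_top. of_real (C * inverse T ^ (p - d + (q - e)))
      = integral {0..T} (\<lambda>t. kern l p d T t * cnj (kern l q e T t))"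
    using eventually_ge_at_top[of 1]
  proof eventually_elim
    case (elim T)
    let ?s = "T powr (- real p - 1/2) * T powr (- real q - 1/2)"
    define N where "N = complex_of_nat (Suc (d + e))"
    have N: "inverse N * (N * z) = z" for z
    proof -
      have "N \<noteq> 0" unfolding N_def by (rule of_nat_neq_0)
      then show ?thesis by simp
    qed
    \<comment> \<open>With \<open>c = 0\<close> the exponential is 1 and the derivative formula is
      the power rule.\<close>
    have "((\<lambda>t. N * of_real t ^ (d + e)) has_integral of_real T ^ Suc (d + e)) {0..T}"
      using has_integral_deriv_exp_moment[of T "Suc (d + e)" 0] elim by (simp add: N_def)
    from has_integral_mult_right[OF this, of "inverse N"]
    have "((\<lambda>t. of_real t ^ (d + e)) has_integral inverse N * of_real T ^ Suc (d + e)) {0..T}"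
      by (simp only: N)
    also have "inverse N * of_real T ^ Suc (d + e) = of_real (T ^ Suc (d + e) / real (Suc (d + e)))"
      by (simp add: N_def divide_inverse mult.commute del: of_nat_Suc)
    finally have "((\<lambda>t. complex_of_real t ^ (d + e)) has_integral of_real (T ^ Suc (d + e) / real (Suc (d + e)))) {0..T}" .
    then have M: "exp_moment 0 (d + e) T = of_real (T ^ Suc (d + e) / real (Suc (d + e)))"
      unfolding exp_moment_def by (simp add: integral_unique)
    have "integral {0..T} (\<lambda>t. kern l p d T t * cnj (kern l q e T t))
        = integral {0..T} (\<lambda>t. of_real ?s * (jexp l d t * cnj (jexp l e t)))"
      using assms by (simp add: kern_def mult_ac)
    also have "\<dots> = of_real ?s * (of_real (T ^ Suc (d + e) / real (Suc (d + e))) / (fact d * fact e))"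
      by (simp only: integral_mult_right integral_jexp_mult l M)
    also have "\<dots> = of_real (C * (?s * T ^ Suc (d + e)))"
      by (simp add: C_def)
    also have "?s * T ^ Suc (d + e) = inverse T ^ (p - d + (q - e))"
    proof -
      have "T ^ Suc (d + e) = T powr real (Suc (d + e))"
        using elim by (intro powr_realpow[symmetric]) auto
      then have "?s * T ^ Suc (d + e) = T powr (- real (p - d + (q - e)))"
        using assms by (simp add: powr_add[symmetric] of_nat_diff algebra_simps)
      also have "\<dots> = inverse T ^ (p - d + (q - e))"
        using elim by (simp only: powr_minus) (subst powr_realpow, auto simp: power_inverse)
      finally show ?thesis .
    qed
    finally show ?case by simp
  qed
  \<comment> \<open>The exponent may be 0: the convention \<open>0 ^ 0 = 1\<close> in the limit
    produces the case distinction of the claim.\<close>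
  have "((\<lambda>T. inverse T ^ k) \<longlongrightarrow> (0::real) ^ k) at_top" for k
    by (intro tendsto_power tendsto_inverse_0_at_top filterlim_ident)
  from tendsto_of_real[OF tendsto_mult_left[OF this], of C "p - d + (q - e)"]
  have "((\<lambda>T. complex_of_real (C * inverse T ^ (p - d + (q - e)))) \<longlongrightarrow>
      of_real (C * 0 ^ (p - d + (q - e)))) at_top" .
  moreover have "complex_of_real (C * 0 ^ (p - d + (q - e)))
      = (if d = p \<and> e = q then 1 / (fact p * fact q * of_nat (p + q + 1)) else 0)"
    using assms by (auto simp: C_def)
  ultimately show ?thesis
    using Lim_transform_eventually[OF _ ev] by simp
qed

text \<open>The hypothesis describes the pairs of eigenvalues that lie outside the diagonal blocks
  of the limit: different groups, or distinct points of the imaginary axis.\<close>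

lemma kern_limit_0:
  assumes "d \<le> p" "e \<le> q" "sgn (Re l) \<noteq> sgn (Re m) \<or> Re l = 0 \<and> l \<noteq> m"
  shows "((\<lambda>T. integral {0..T} (\<lambda>t. kern l p d T t * cnj (kern m q e T t))) \<longlongrightarrow> 0) at_top"
proof -
  \<comment> \<open>Conjugation exchanges the two factors, so each pair of groups is treated in one
    order only.\<close>
  have sym: ?thesis
    if "((\<lambda>T. integral {0..T} (\<lambda>t. kern m q e T t * cnj (kern l p d T t))) \<longlongrightarrow> 0) at_top"
    using tendsto_cnj[OF that] by (simp add: integral_cnj mult.commute)
  consider "Re l = 0" "Re m = 0" | "Re l = 0" "Re m \<noteq> 0" | "Re l \<noteq> 0" "Re m = 0"
    | "Re l < 0" "0 < Re m" | "0 < Re l" "Re m < 0"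
    | "0 < Re l" "0 < Re m" | "Re l < 0" "Re m < 0"
    by linarith
  then show ?thesis
  proof cases
    case 1
    then show ?thesis using assms by (intro kern_limit_imaginary_distinct) auto
  next
    case 2
    then show ?thesis using assms by (intro sym kern_limit_hyperbolic_imaginary) auto
  next
    case 3
    then show ?thesis using assms by (intro kern_limit_hyperbolic_imaginary) auto
  next
    case 4
    then show ?thesis by (rule kern_limit_neg_pos)
  next
    case 5
    then show ?thesis by (intro sym kern_limit_neg_pos)
  qed (use assms in \<open>auto simp: sgn_if\<close>)
qed

section \<open>Matrix products, adjoints and inverses\<close>

lemma mult_mat_index_sum:
  assumes "A \<in> carrier_mat n m" "B \<in> carrier_mat m k" "i < n" "j < k"
  shows "(A * B) $$ (i, j) = (\<Sum>p<m. A $$ (i, p) * B $$ (p, j))"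
  using assms by (auto simp: scalar_prod_def atLeast0LessThan intro!: sum.cong)

lemma mat_adjoint_dim [simp]:
  "dim_row (mat_adjoint A) = dim_col A" "dim_col (mat_adjoint A) = dim_row A"
  by (simp_all add: mat_adjoint_def)

lemma mat_adjoint_carrier [simp, intro]:
  "A \<in> carrier_mat n m \<Longrightarrow> mat_adjoint A \<in> carrier_mat m n"
  by (intro carrier_matI) auto

lemma mat_adjoint_index:
  fixes A :: "complex mat"
  assumes "i < dim_col A" "j < dim_row A"
  shows "mat_adjoint A $$ (i, j) = cnj (A $$ (j, i))"
  using assms by (simp add: mat_adjoint_def mat_of_rows_index)

lemma mat_adjoint_mult:
  fixes A B :: "complex mat"
  assumes "A \<in> carrier_mat n m" "B \<in> carrier_mat m k"
  shows "mat_adjoint (A * B) = mat_adjoint B * mat_adjoint A"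
proof (rule eq_matI)
  fix i j assume "i < dim_row (mat_adjoint B * mat_adjoint A)" "j < dim_col (mat_adjoint B * mat_adjoint A)"
  then have i: "i < k" and j: "j < n" using assms by auto
  have "mat_adjoint (A * B) $$ (i, j) = cnj ((A * B) $$ (j, i))"
    using assms i j by (intro mat_adjoint_index) auto
  also have "\<dots> = (\<Sum>p<m. mat_adjoint B $$ (i, p) * mat_adjoint A $$ (p, j))"
    using assms i j by (auto simp: mult_mat_index_sum[OF assms j i] mat_adjoint_index intro!: sum.cong)
  also have "\<dots> = (mat_adjoint B * mat_adjoint A) $$ (i, j)"
    using assms i j by (intro mult_mat_index_sum[symmetric]) auto
  finally show "mat_adjoint (A * B) $$ (i, j) = (mat_adjoint B * mat_adjoint A) $$ (i, j)" .
qed (use assms in auto)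

text \<open>Integrals, limits and derivatives of such products are taken termwise in this double
  sum. The outer matrices may differ because the product rule creates terms with
  \<open>F * E t\<close> on one side and \<open>E t\<close> on the other.\<close>

lemma sandwich_index:
  fixes A B C :: "complex mat"
  assumes "A \<in> carrier_mat n n" "B \<in> carrier_mat n n" "C \<in> carrier_mat n n" "i < n" "j < n"
  shows "(A * B * mat_adjoint C) $$ (i, j)
    = (\<Sum>p<n. \<Sum>q<n. A $$ (i, p) * B $$ (p, q) * cnj (C $$ (j, q)))"
proof -
  have "(A * B * mat_adjoint C) $$ (i, j) = (\<Sum>q<n. (A * B) $$ (i, q) * mat_adjoint C $$ (q, j))"
    using assms by (intro mult_mat_index_sum) auto
  also have "\<dots> = (\<Sum>q<n. \<Sum>p<n. A $$ (i, p) * B $$ (p, q) * cnj (C $$ (j, q)))"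
    using assms
    by (intro sum.cong refl)
      (simp add: mult_mat_index_sum[OF assms(1,2,4)] mat_adjoint_index sum_distrib_right del: index_mult_mat(1))
  also have "\<dots> = (\<Sum>p<n. \<Sum>q<n. A $$ (i, p) * B $$ (p, q) * cnj (C $$ (j, q)))"
    by (rule sum.swap)
  finally show ?thesis .
qed

lemma mat_inv_eqI:
  assumes "A \<in> carrier_mat n n" "B \<in> carrier_mat n n" "B * A = 1\<^sub>m n" "A * B = 1\<^sub>m n"
  shows "mat_inv A = B"
proof -
  \<comment> \<open>Being a unit of the matrix ring excludes the result \<open>None\<close>, for
    which \<open>mat_inv\<close> would be unspecified.\<close>
  have "A \<in> Units (ring_mat TYPE('a) n ())"
    unfolding Units_def using assms by (auto simp: ring_mat_simps)
  then obtain C where C: "mat_inverse A = Some C"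
    using mat_inverse(1)[OF assms(1), where b = "()"] by (cases "mat_inverse A") auto
  note C' = mat_inverse(2)[OF assms(1) C]
  have "C = C * (A * B)" using C' assms by (simp add: right_mult_one_mat[of C n n])
  also have "\<dots> = C * A * B" using C' assms by (intro assoc_mult_mat[symmetric]) auto
  also have "\<dots> = B" using C' assms by simp
  finally show ?thesis unfolding mat_inv_def C by simp
qed

lemma mat_inv_invertible:
  assumes "A \<in> carrier_mat n n" "invertible_mat A"
  shows "mat_inv A \<in> carrier_mat n n" "mat_inv A * A = 1\<^sub>m n" "A * mat_inv A = 1\<^sub>m n"
proof -
  obtain B where B: "A * B = 1\<^sub>m n" "B * A = 1\<^sub>m (dim_row B)"
    using assms by (auto simp: invertible_mat_def inverts_mat_def)
  have "dim_col B = n" using arg_cong[OF B(1), of dim_col] by simp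
  moreover have "dim_row B = n" using arg_cong[OF B(2), of dim_col] assms(1) by simp
  ultimately have "B \<in> carrier_mat n n" by (intro carrier_matI)
  moreover from this have "mat_inv A = B" using B assms(1) by (intro mat_inv_eqI) auto
  ultimately show "mat_inv A \<in> carrier_mat n n" "mat_inv A * A = 1\<^sub>m n" "A * mat_inv A = 1\<^sub>m n"
    using B by auto
qed

section \<open>Block indices\<close>

lemma block_off_0 [simp]: "block_off ks 0 = 0"
  by (simp add: block_off_def)

lemma block_off_Suc: "i < length ks \<Longrightarrow> block_off ks (Suc i) = block_off ks i + ks ! i"
  by (simp add: block_off_def take_Suc_conv_app_nth)

lemma block_off_Cons_Suc [simp]: "block_off (k # ks) (Suc i) = k + block_off ks i"
  by (simp add: block_off_def)

lemma block_off_length: "length ks \<le> i \<Longrightarrow> block_off ks i = sum_list ks"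
  by (simp add: block_off_def)

lemma block_off_add: "block_off ks (i + j) = block_off ks i + block_off (drop i ks) j"
  by (simp add: block_off_def take_add)

lemma block_off_mono: "i \<le> j \<Longrightarrow> block_off ks i \<le> block_off ks j"
  using block_off_add[of ks i "j - i"] by simp

lemma block_off_take: "i \<le> m \<Longrightarrow> block_off (take m ks) i = block_off ks i"
  by (simp add: block_off_def min_absorb1)

lemma block_off_le_sum_list: "block_off ks i \<le> sum_list ks"
  using block_off_mono[of i "max i (length ks)" ks] block_off_length[of ks "max i (length ks)"] by simp

lemma block_index_less:
  assumes "i < j" "j \<le> length ks" "a < ks ! i"
  shows "block_off ks i + a < block_off ks j"
  using block_off_mono[of "Suc i" j ks] assms by (simp add: block_off_Suc)

lemma block_index_less_sum_list:
  assumes "i < length ks" "a < ks ! i"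
  shows "block_off ks i + a < sum_list ks"
  using block_index_less[of i "length ks" ks a] assms by (simp add: block_off_length)

lemma block_indexE:
  assumes "r < sum_list ks"
  obtains i a where "i < length ks" "a < ks ! i" "r = block_off ks i + a"
proof -
  have "\<exists>i a. i < length ks \<and> a < ks ! i \<and> r = block_off ks i + a"
    using assms
  proof (induction ks arbitrary: r)
    case (Cons k ks)
    show ?case
    proof (cases "r < k")
      case True
      then show ?thesis by (intro exI[of _ 0] exI[of _ r]) simp
    next
      case False
      with Cons.prems have "\<exists>i a. i < length ks \<and> a < ks ! i \<and> r - k = block_off ks i + a"
        by (intro Cons.IH) auto
      then obtain i a where "i < length ks" "a < ks ! i" "r - k = block_off ks i + a"
        by blast
      with False show ?thesis by (intro exI[of _ "Suc i"] exI[of _ a]) simp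
    qed
  qed simp
  with that show thesis by blast
qed

lemma block_of_index:
  assumes "i < length ks" "a < ks ! i"
  shows "block_of ks (block_off ks i + a) = i"
  unfolding block_of_def
proof (rule Least_equality)
  show "block_off ks i + a < block_off ks (Suc i)"
    using assms by (simp add: block_off_Suc)
  fix y assume "block_off ks i + a < block_off ks (Suc y)"
  then show "i \<le> y"
    using block_off_mono[of "Suc y" i ks] by (cases "i \<le> y") auto
qed

lemma block_mat_index:
  assumes "i < length ks" "a < ks ! i" "j < length ks" "b < ks ! j"
  shows "block_mat ks F $$ (block_off ks i + a, block_off ks j + b) = F i j $$ (a, b)"
  using assms by (simp add: block_mat_def block_index_less_sum_list block_of_index)

lemma sum_over_blocks:
  fixes g :: "nat \<Rightarrow> 'a::comm_monoid_add"
  shows "(\<Sum>p<sum_list ks. g p) = (\<Sum>i<length ks. \<Sum>c<ks ! i. g (block_off ks i + c))"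
proof (induction ks arbitrary: g)
  case (Cons k ks)
  have "(\<Sum>p<k + m. g p) = (\<Sum>p<k. g p) + (\<Sum>p<m. g (k + p))" for m
    by (induction m) (simp_all add: add.assoc)
  then show ?case
    by (simp add: Cons.IH sum.lessThan_Suc_shift add.assoc del: sum.lessThan_Suc)
qed simp

text \<open>The sizes enter as one list \<open>ks\<close>, so that scaling, exponential and kernel,
  which share the block structure of the Jordan matrix, are indexed alike.\<close>

lemma diag_block_mat_index:
  assumes "map dim_row As = ks" "map dim_col As = ks"
    and "i < length ks" "a < ks ! i" "j < length ks" "b < ks ! j"
  shows "diag_block_mat As $$ (block_off ks i + a, block_off ks j + b)
    = (if i = j then (As ! i) $$ (a, b) else 0)"
  using assms
proof (induction As arbitrary: ks i j)
  case (Cons A As)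
  obtain k ks' where ks: "ks = k # ks'" "dim_row A = k" "dim_col A = k"
    "map dim_row As = ks'" "map dim_col As = ks'"
    using Cons.prems(1,2) by auto
  have dim: "dim_row (diag_block_mat As) = sum_list ks'" "dim_col (diag_block_mat As) = sum_list ks'"
    using ks by (simp_all add: dim_diag_block_mat)
  have less: "block_off ks' i' + a' < sum_list ks'" if "i' < length ks'" "a' < ks' ! i'" for i' a'
    using that by (rule block_index_less_sum_list)
  show ?case
  proof (cases i)
    case 0
    then show ?thesis
      using Cons.prems ks dim by (cases j) (auto simp: Let_def less)
  next
    case (Suc i')
    then show ?thesis
      using Cons.prems ks dim Cons.IH[OF ks(4,5), of i' "j - 1"]
      by (cases j) (auto simp: Let_def less)
  qed
qed simp

lemma diag_block_mat_row_sum: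
  fixes x :: "nat \<Rightarrow> 'a::comm_ring_1"
  assumes ks: "map dim_row As = ks" "map dim_col As = ks"
    and i: "i < length ks" and a: "a < ks ! i"
  shows "(\<Sum>p<sum_list ks. diag_block_mat As $$ (block_off ks i + a, p) * x p)
    = (\<Sum>c<ks ! i. (As ! i) $$ (a, c) * x (block_off ks i + c))"
proof -
  have "(\<Sum>p<sum_list ks. diag_block_mat As $$ (block_off ks i + a, p) * x p)
      = (\<Sum>j<length ks. \<Sum>c<ks ! j. (if i = j then (As ! i) $$ (a, c) else 0) * x (block_off ks j + c))"
    unfolding sum_over_blocks
    by (intro sum.cong refl) (simp add: diag_block_mat_index[OF ks i a])
  also have "\<dots> = (\<Sum>j<length ks. if i = j then \<Sum>c<ks ! i. (As ! i) $$ (a, c) * x (block_off ks i + c) else 0)"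
    by (intro sum.cong refl) auto
  also have "\<dots> = (\<Sum>c<ks ! i. (As ! i) $$ (a, c) * x (block_off ks i + c))"
    using i by simp
  finally show ?thesis .
qed

lemma diag_block_mat_carrier:
  assumes "map dim_row As = ks" "map dim_col As = ks"
  shows "diag_block_mat As \<in> carrier_mat (sum_list ks) (sum_list ks)"
  using assms by (intro carrier_matI) (simp_all add: dim_diag_block_mat)

text \<open>With block-diagonal outer factors only the block of \<open>B\<close> at the same
  position contributes, so each pair of Jordan blocks can be treated separately.\<close>

lemma sandwich_block_index:
  fixes B :: "complex mat"
  assumes ks: "map dim_row As = ks" "map dim_col As = ks"
    and B: "B \<in> carrier_mat (sum_list ks) (sum_list ks)"
    and i: "i < length ks" "a < ks ! i" and j: "j < length ks" "b < ks ! j"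
  shows "(diag_block_mat As * B * mat_adjoint (diag_block_mat As)) $$ (block_off ks i + a, block_off ks j + b)
    = (\<Sum>c<ks ! i. \<Sum>d<ks ! j. B $$ (block_off ks i + c, block_off ks j + d)
        * ((As ! i) $$ (a, c) * cnj ((As ! j) $$ (b, d))))"
proof -
  let ?A = "diag_block_mat As"
  let ?r = "block_off ks i + a" and ?s = "block_off ks j + b"
  have "(?A * B * mat_adjoint ?A) $$ (?r, ?s)
      = (\<Sum>p<sum_list ks. ?A $$ (?r, p) * (\<Sum>q<sum_list ks. B $$ (p, q) * cnj (?A $$ (?s, q))))"
    using B i j
    by (subst sandwich_index[of _ "sum_list ks"])
      (auto simp: diag_block_mat_carrier[OF ks] block_index_less_sum_list sum_distrib_left mult_ac)
  also have "\<dots> = (\<Sum>c<ks ! i. (As ! i) $$ (a, c) *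
      (\<Sum>q<sum_list ks. B $$ (block_off ks i + c, q) * cnj (?A $$ (?s, q))))"
    by (rule diag_block_mat_row_sum[OF ks i])
  \<comment> \<open>Conjugating the inner sum turns it into a row sum of the block-diagonal matrix,
    so the rule used for the outer sum collapses it as well.\<close>
  also have "\<dots> = (\<Sum>c<ks ! i. (As ! i) $$ (a, c) *
      cnj (\<Sum>q<sum_list ks. ?A $$ (?s, q) * cnj (B $$ (block_off ks i + c, q))))"
    by (simp add: mult.commute)
  also have "\<dots> = (\<Sum>c<ks ! i. (As ! i) $$ (a, c) *
      cnj (\<Sum>d<ks ! j. (As ! j) $$ (b, d) * cnj (B $$ (block_off ks i + c, block_off ks j + d))))"
    by (simp only: diag_block_mat_row_sum[OF ks j])
  also have "\<dots> = (\<Sum>c<ks ! i. \<Sum>d<ks ! j. B $$ (block_off ks i + c, block_off ks j + d)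
        * ((As ! i) $$ (a, c) * cnj ((As ! j) $$ (b, d))))"
    by (simp add: sum_distrib_left mult_ac)
  finally show ?thesis .
qed

section \<open>Matrix exponentials\<close>

lemma smult_pow_mat:
  fixes A :: "'a::comm_ring_1 mat"
  assumes "A \<in> carrier_mat n n"
  shows "(c \<cdot>\<^sub>m A) ^\<^sub>m k = c ^ k \<cdot>\<^sub>m A ^\<^sub>m k"
proof (induction k)
  case (Suc k)
  have P: "A ^\<^sub>m k \<in> carrier_mat n n" using assms by simp
  have "(c \<cdot>\<^sub>m A) ^\<^sub>m Suc k = (c ^ k \<cdot>\<^sub>m A ^\<^sub>m k) * (c \<cdot>\<^sub>m A)" by (simp add: Suc)
  also have "\<dots> = c ^ k \<cdot>\<^sub>m (A ^\<^sub>m k * (c \<cdot>\<^sub>m A))"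
    using assms P by (intro mult_smult_assoc_mat) auto
  also have "\<dots> = c ^ k \<cdot>\<^sub>m (c \<cdot>\<^sub>m (A ^\<^sub>m k * A))"
    using assms P by (subst mult_smult_distrib) auto
  also have "\<dots> = c ^ Suc k \<cdot>\<^sub>m A ^\<^sub>m Suc k"
    by (intro eq_matI) (use assms in auto)
  finally show ?case .
qed (use assms in \<open>intro eq_matI; auto\<close>)

text \<open>A relation that asserts convergence of the exponential series along with its value; an
  equation for \<open>mat_exp\<close> alone would not carry convergence through similarity and
  adjoints.\<close>

definition exp_sums :: "complex mat \<Rightarrow> complex mat \<Rightarrow> bool" where
  "exp_sums A E \<longleftrightarrow> dim_row E = dim_row A \<and> dim_col E = dim_row A \<and>
     (\<forall>i<dim_row A. \<forall>j<dim_row A. (\<lambda>k. (A ^\<^sub>m k) $$ (i, j) / fact k) sums (E $$ (i, j)))"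

lemma mat_exp_eqI: "exp_sums A E \<Longrightarrow> mat_exp A = E"
  by (intro eq_matI) (auto simp: mat_exp_def exp_sums_def sums_iff)

lemma similar_pow_mat:
  fixes J :: "'a::comm_ring_1 mat"
  assumes "J \<in> carrier_mat n n" "Q \<in> carrier_mat n n" "P \<in> carrier_mat n n" "P * Q = 1\<^sub>m n" "Q * P = 1\<^sub>m n"
  shows "(Q * J * P) ^\<^sub>m k = Q * J ^\<^sub>m k * P"
  by (rule similar_mat_wit_pow_id[of _ _ Q P]) (use assms in \<open>auto simp: similar_mat_wit_def Let_def\<close>)

text \<open>Similarity commutes with powers, and every entry of the result is a finite linear
  combination of entries of the powers, so the series may be summed termwise.\<close>

lemma exp_sums_similar:
  assumes J: "J \<in> carrier_mat n n" and Q: "Q \<in> carrier_mat n n" and P: "P \<in> carrier_mat n n"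
    and inv: "P * Q = 1\<^sub>m n" "Q * P = 1\<^sub>m n" and E: "exp_sums J E"
  shows "exp_sums (Q * J * P) (Q * E * P)"
proof -
  have Ec: "E \<in> carrier_mat n n" using E J by (auto simp: exp_sums_def)
  have idx: "(Q * M * P) $$ (i, j) = (\<Sum>q<n. \<Sum>p<n. Q $$ (i, p) * M $$ (p, q) * P $$ (q, j))"
    if "M \<in> carrier_mat n n" "i < n" "j < n" for M i j
  proof -
    have "(Q * M * P) $$ (i, j) = (\<Sum>q<n. (Q * M) $$ (i, q) * P $$ (q, j))"
      using that Q P by (intro mult_mat_index_sum) auto
    also have "\<dots> = (\<Sum>q<n. (\<Sum>p<n. Q $$ (i, p) * M $$ (p, q)) * P $$ (q, j))"
      using that Q by (intro sum.cong refl arg_cong2[where f = "(*)"] mult_mat_index_sum) auto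
    finally show ?thesis by (simp add: sum_distrib_right)
  qed
  have "(\<lambda>k. ((Q * J * P) ^\<^sub>m k) $$ (i, j) / fact k) sums ((Q * E * P) $$ (i, j))"
    if "i < n" "j < n" for i j
  proof -
    have "(\<lambda>k. \<Sum>q<n. \<Sum>p<n. Q $$ (i, p) * ((J ^\<^sub>m k) $$ (p, q) / fact k) * P $$ (q, j))
        sums (\<Sum>q<n. \<Sum>p<n. Q $$ (i, p) * E $$ (p, q) * P $$ (q, j))"
      using E J by (intro sums_sum sums_mult sums_mult2) (auto simp: exp_sums_def)
    then show ?thesis
      using that J Ec by (simp add: similar_pow_mat[OF J Q P inv] idx sum_divide_distrib)
  qed
  then show ?thesis
    using Q P by (auto simp: exp_sums_def)
qed

lemma exp_sums_adjoint:
  assumes A: "A \<in> carrier_mat n n" and E: "exp_sums A E"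
  shows "exp_sums (mat_adjoint A) (mat_adjoint E)"
proof -
  \<comment> \<open>A power gains its new factor on the right, while taking adjoints moves it to the
    left; commuting \<open>A\<close> past its power repairs the order.\<close>
  have comm: "A * A ^\<^sub>m k = A ^\<^sub>m k * A" for k
  proof (induction k)
    case (Suc k)
    have "A * A ^\<^sub>m Suc k = A * A ^\<^sub>m k * A"
      using A by (simp add: assoc_mult_mat[of A n n "A ^\<^sub>m k" n A n])
    then show ?case by (simp add: Suc)
  qed (use A in simp)
  have pow: "mat_adjoint A ^\<^sub>m k = mat_adjoint (A ^\<^sub>m k)" for k
  proof (induction k)
    case 0
    show ?case using A by (intro eq_matI) (auto simp: mat_adjoint_index)
  next
    case (Suc k)
    have "mat_adjoint A ^\<^sub>m Suc k = mat_adjoint (A ^\<^sub>m k) * mat_adjoint A"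
      by (simp add: Suc)
    also have "\<dots> = mat_adjoint (A * A ^\<^sub>m k)"
      using A by (intro mat_adjoint_mult[symmetric]) auto
    also have "A * A ^\<^sub>m k = A ^\<^sub>m Suc k"
      by (simp add: comm)
    finally show ?case .
  qed
  have "(\<lambda>k. (mat_adjoint A ^\<^sub>m k) $$ (i, j) / fact k) sums (mat_adjoint E $$ (i, j))"
    if "i < n" "j < n" for i j
  proof -
    have "(\<lambda>k. cnj ((A ^\<^sub>m k) $$ (j, i) / fact k)) sums cnj (E $$ (j, i))"
      using E that A by (subst sums_cnj) (auto simp: exp_sums_def)
    then show ?thesis
      using that A E by (simp add: pow mat_adjoint_index exp_sums_def)
  qed
  then show ?thesis
    using A E by (auto simp: exp_sums_def)
qed

definition jordan_block_exp :: "nat \<Rightarrow> complex \<Rightarrow> real \<Rightarrow> complex mat" where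
  "jordan_block_exp k l t = Matrix.mat k k (\<lambda>(a, c). if a \<le> c then jexp l (c - a) t else 0)"

definition jordan_exp :: "(nat \<times> complex) list \<Rightarrow> real \<Rightarrow> complex mat" where
  "jordan_exp js t = diag_block_mat (map (\<lambda>(k, l). jordan_block_exp k l t) js)"

lemma jordan_block_exp_dim [simp]:
  "dim_row (jordan_block_exp k l t) = k" "dim_col (jordan_block_exp k l t) = k"
  by (simp_all add: jordan_block_exp_def)

text \<open>These are the coefficients from the binomial formula for powers of a Jordan block. The
  terms with \<open>m < d\<close> vanish with the binomial coefficient; after a shift by
  \<open>d\<close> the factorials cancel and the series of \<open>exp (l * t)\<close>
  remains.\<close>

lemma jexp_sums:
  "(\<lambda>m. of_real t ^ m * (of_nat (m choose d) * l ^ (m - d)) / fact m) sums jexp l d t"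
proof -
  have "(\<lambda>m. of_real t ^ (m + d) * (of_nat ((m + d) choose d) * l ^ (m + d - d)) / fact (m + d)) sums jexp l d t"
  proof -
    have "(\<lambda>m. (l * of_real t) ^ m /\<^sub>R fact m * (of_real t ^ d / fact d)) sums
        (exp (l * of_real t) * (of_real t ^ d / fact d))"
      by (intro sums_mult2 exp_converges)
    moreover have "(l * of_real t) ^ m /\<^sub>R fact m * (of_real t ^ d / fact d)
        = of_real t ^ (m + d) * (of_nat ((m + d) choose d) * l ^ (m + d - d)) / fact (m + d)" for m
    proof -
      have "of_nat ((m + d) choose d) = (fact (m + d) / (fact d * fact m) :: complex)"
        using binomial_fact[of d "m + d", where ?'a = complex] by simp
      then show ?thesis
        by (simp add: scaleR_conv_of_real power_mult_distrib power_add divide_inverse mult_ac)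
    qed
    ultimately show ?thesis by (simp add: jexp_def)
  qed
  then show ?thesis
    by (subst (asm) sums_zero_iff_shift) (auto simp: binomial_eq_0)
qed

lemma exp_sums_jordan_block:
  "exp_sums (complex_of_real t \<cdot>\<^sub>m jordan_block k l) (jordan_block_exp k l t)"
proof -
  have "(\<lambda>m. ((complex_of_real t \<cdot>\<^sub>m jordan_block k l) ^\<^sub>m m) $$ (a, c) / fact m)
      sums (jordan_block_exp k l t $$ (a, c))" if "a < k" "c < k" for a c
  proof -
    have eq: "((complex_of_real t \<cdot>\<^sub>m jordan_block k l) ^\<^sub>m m) $$ (a, c)
        = (if a \<le> c then of_real t ^ m * (of_nat (m choose (c - a)) * l ^ (m - (c - a))) else 0)" for m
      using that by (simp add: smult_pow_mat[OF jordan_block_carrier] jordan_block_pow)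
    show ?thesis
      unfolding eq using jexp_sums[of t "c - a" l] that
      by (cases "a \<le> c") (auto simp: jordan_block_exp_def)
  qed
  then show ?thesis by (simp add: exp_sums_def)
qed

lemma map_jordan_block_dims:
  "map dim_row (map (\<lambda>(k, l). jordan_block_exp k l t) js) = map fst js"
  "map dim_col (map (\<lambda>(k, l). jordan_block_exp k l t) js) = map fst js"
  "map dim_row (map (\<lambda>(k, l). jordan_block k l) js) = map fst js"
  "map dim_col (map (\<lambda>(k, l). jordan_block k l) js) = map fst js"
  by (auto simp: split_def)

lemma exp_sums_jordan_matrix:
  "exp_sums (complex_of_real t \<cdot>\<^sub>m jordan_matrix js) (jordan_exp js t)"
proof -
  let ?ks = "map fst js"
  have "(\<lambda>m. ((complex_of_real t \<cdot>\<^sub>m jordan_matrix js) ^\<^sub>m m) $$ (r, s) / fact m)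
      sums (jordan_exp js t $$ (r, s))" if r: "r < sum_list ?ks" and s: "s < sum_list ?ks" for r s
  proof -
    obtain i a where i: "i < length ?ks" "a < ?ks ! i" "r = block_off ?ks i + a"
      using r by (rule block_indexE)
    obtain j b where j: "j < length ?ks" "b < ?ks ! j" "s = block_off ?ks j + b"
      using s by (rule block_indexE)
    have pow: "((complex_of_real t \<cdot>\<^sub>m jordan_matrix js) ^\<^sub>m m) $$ (r, s)
        = (if i = j then ((complex_of_real t \<cdot>\<^sub>m jordan_block (fst (js ! i)) (snd (js ! i))) ^\<^sub>m m) $$ (a, b) else 0)"
      for m
    proof -
      have "((complex_of_real t \<cdot>\<^sub>m jordan_matrix js) ^\<^sub>m m) $$ (r, s)
          = of_real t ^ m * diag_block_mat (map (\<lambda>(k, l). jordan_block k l ^\<^sub>m m) js) $$ (r, s)"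
        using r s by (simp add: smult_pow_mat[OF jordan_matrix_carrier] flip: jordan_matrix_pow)
      also have "diag_block_mat (map (\<lambda>(k, l). jordan_block k l ^\<^sub>m m) js) $$ (r, s)
          = (if i = j then (map (\<lambda>(k, l). jordan_block k l ^\<^sub>m m) js ! i) $$ (a, b) else 0)"
        unfolding i j by (rule diag_block_mat_index) (use i j in \<open>auto simp: split_def\<close>)
      finally show ?thesis
        using i j by (auto simp: smult_pow_mat[OF jordan_block_carrier] split_def)
    qed
    have E: "jordan_exp js t $$ (r, s)
        = (if i = j then jordan_block_exp (fst (js ! i)) (snd (js ! i)) t $$ (a, b) else 0)"
      unfolding jordan_exp_def i j
      by (subst diag_block_mat_index[OF map_jordan_block_dims(1,2)]) (use i j in \<open>auto simp: split_def\<close>)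
    show ?thesis
      unfolding pow E using exp_sums_jordan_block[of t "fst (js ! i)" "snd (js ! i)"] i j
      by (auto simp: exp_sums_def)
  qed
  then show ?thesis
    using diag_block_mat_carrier[OF map_jordan_block_dims(1,2), of t js]
    by (auto simp: exp_sums_def jordan_exp_def)
qed

section \<open>The exponential of a Jordan matrix\<close>

lemma jordan_exp_carrier [simp]:
  "jordan_exp js t \<in> carrier_mat (sum_list (map fst js)) (sum_list (map fst js))"
  unfolding jordan_exp_def by (rule diag_block_mat_carrier[OF map_jordan_block_dims(1,2)])

lemma jordan_exp_dim [simp]:
  "dim_row (jordan_exp js t) = sum_list (map fst js)" "dim_col (jordan_exp js t) = sum_list (map fst js)"
  using jordan_exp_carrier[of js t] by (auto simp del: jordan_exp_carrier)

lemma jordan_exp_index: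
  assumes "i < length js" "a < fst (js ! i)" "j < length js" "b < fst (js ! j)"
  shows "jordan_exp js t $$ (j_off js i + a, j_off js j + b)
    = (if i = j then jordan_block_exp (fst (js ! i)) (snd (js ! i)) t $$ (a, b) else 0)"
  unfolding jordan_exp_def
  by (subst diag_block_mat_index[OF map_jordan_block_dims(1,2)]) (use assms in \<open>auto simp: split_def\<close>)

text \<open>The alternatives hold for all \<open>t\<close> at once, so limits and integrals of
  matrix entries reduce to the scalar statements about \<open>jexp\<close>.\<close>

lemma jordan_exp_index_cases:
  assumes "r < sum_list (map fst js)" "s < sum_list (map fst js)"
  obtains "\<And>t. jordan_exp js t $$ (r, s) = 0"
    | k l d where "(k, l) \<in> set js" "\<And>t. jordan_exp js t $$ (r, s) = jexp l d t"
proof -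
  obtain i a where i: "i < length js" "a < fst (js ! i)" "r = j_off js i + a"
    using assms(1) by (rule block_indexE) simp
  obtain j b where j: "j < length js" "b < fst (js ! j)" "s = j_off js j + b"
    using assms(2) by (rule block_indexE) simp
  show thesis
  proof (cases "i = j \<and> a \<le> b")
    case True
    then have "jordan_exp js t $$ (r, s) = jexp (snd (js ! i)) (b - a) t" for t
      using i j by (simp add: jordan_exp_index jordan_block_exp_def)
    then show thesis
      using i(1) that(2)[of "fst (js ! i)" "snd (js ! i)" "b - a"] by simp
  next
    case False
    then have "jordan_exp js t $$ (r, s) = 0" for t
      using i j by (auto simp: jordan_exp_index jordan_block_exp_def)
    then show thesis by (rule that(1))
  qed
qed

lemma jexp_0: "jexp l d 0 = (if d = 0 then 1 else 0)"
  by (simp add: jexp_def)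

lemma jordan_exp_0: "jordan_exp js 0 = 1\<^sub>m (sum_list (map fst js))"
proof (rule eq_matI)
  fix r s assume "r < dim_row (1\<^sub>m (sum_list (map fst js)) :: complex mat)"
    "s < dim_col (1\<^sub>m (sum_list (map fst js)) :: complex mat)"
  then have r: "r < sum_list (map fst js)" and s: "s < sum_list (map fst js)" by auto
  obtain i a where i: "i < length js" "a < fst (js ! i)" "r = j_off js i + a"
    using r by (rule block_indexE) simp
  obtain j b where j: "j < length js" "b < fst (js ! j)" "s = j_off js j + b"
    using s by (rule block_indexE) simp
  have "r = s \<longleftrightarrow> i = j \<and> a = b"
    using block_of_index[of i "map fst js" a] block_of_index[of j "map fst js" b] i j by auto
  then show "jordan_exp js 0 $$ (r, s) = 1\<^sub>m (sum_list (map fst js)) $$ (r, s)"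
    using r s i j by (auto simp: jordan_exp_index jordan_block_exp_def jexp_0 split: if_splits)
qed auto

lemma diag_block_mat_mult:
  fixes f g :: "'b \<Rightarrow> 'a::comm_ring_1 mat"
  assumes "\<And>x. x \<in> set xs \<Longrightarrow> f x \<in> carrier_mat (k x) (k x)"
    and "\<And>x. x \<in> set xs \<Longrightarrow> g x \<in> carrier_mat (k x) (k x)"
  shows "diag_block_mat (map f xs) * diag_block_mat (map g xs) = diag_block_mat (map (\<lambda>x. f x * g x) xs)"
  using assms
proof (induction xs)
  case (Cons x xs)
  let ?k = "sum_list (map k xs)"
  have dims: "map dim_row (map f xs) = map k xs" "map dim_col (map f xs) = map k xs"
    "map dim_row (map g xs) = map k xs" "map dim_col (map g xs) = map k xs"
    using Cons.prems by auto
  have F: "diag_block_mat (map f xs) \<in> carrier_mat ?k ?k" and G: "diag_block_mat (map g xs) \<in> carrier_mat ?k ?k"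
    using diag_block_mat_carrier[OF dims(1,2)] diag_block_mat_carrier[OF dims(3,4)] by auto
  have x: "f x \<in> carrier_mat (k x) (k x)" "g x \<in> carrier_mat (k x) (k x)" using Cons.prems by auto
  have FG: "diag_block_mat (map f xs) * diag_block_mat (map g xs) = diag_block_mat (map (\<lambda>x. f x * g x) xs)"
    using Cons by simp
  have "diag_block_mat (map f (x # xs)) * diag_block_mat (map g (x # xs))
      = four_block_mat (f x) (0\<^sub>m (k x) ?k) (0\<^sub>m ?k (k x)) (diag_block_mat (map f xs))
        * four_block_mat (g x) (0\<^sub>m (k x) ?k) (0\<^sub>m ?k (k x)) (diag_block_mat (map g xs))"
    using x F G by (simp add: Let_def)
  also have "\<dots> = four_block_mat (f x * g x + 0\<^sub>m (k x) ?k * 0\<^sub>m ?k (k x))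
      (f x * 0\<^sub>m (k x) ?k + 0\<^sub>m (k x) ?k * diag_block_mat (map g xs))
      (0\<^sub>m ?k (k x) * g x + diag_block_mat (map f xs) * 0\<^sub>m ?k (k x))
      (0\<^sub>m ?k (k x) * 0\<^sub>m (k x) ?k + diag_block_mat (map f xs) * diag_block_mat (map g xs))"
    by (rule mult_four_block_mat) (use x F G in auto)
  also have "\<dots> = four_block_mat (f x * g x) (0\<^sub>m (k x) ?k) (0\<^sub>m ?k (k x))
      (diag_block_mat (map f xs) * diag_block_mat (map g xs))"
    using x F G by (intro arg_cong4[where f = four_block_mat] eq_matI) auto
  also have "\<dots> = diag_block_mat (map (\<lambda>x. f x * g x) (x # xs))"
    using x carrier_matD[OF mult_carrier_mat[OF F G, unfolded FG]] by (simp add: Let_def FG)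
  finally show ?case .
qed (intro eq_matI; simp)

section \<open>Commutation and the differential equation of the exponential\<close>

lemma jordan_block_mult_left:
  fixes X :: "'a::comm_ring_1 mat"
  assumes "X \<in> carrier_mat k k" "a < k" "b < k"
  shows "(jordan_block k l * X) $$ (a, b) = l * X $$ (a, b) + (if Suc a < k then X $$ (Suc a, b) else 0)"
proof -
  have "(jordan_block k l * X) $$ (a, b) = (\<Sum>p<k. jordan_block k l $$ (a, p) * X $$ (p, b))"
    using assms by (intro mult_mat_index_sum) auto
  also have "\<dots> = (\<Sum>p<k. (if p = a then l * X $$ (a, b) else 0) + (if p = Suc a then X $$ (Suc a, b) else 0))"
    using assms by (intro sum.cong) auto
  also have "\<dots> = l * X $$ (a, b) + (if Suc a < k then X $$ (Suc a, b) else 0)"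
    using assms by (simp add: sum.distrib)
  finally show ?thesis .
qed

lemma jordan_block_mult_right:
  fixes X :: "'a::comm_ring_1 mat"
  assumes "X \<in> carrier_mat k k" "a < k" "b < k"
  shows "(X * jordan_block k l) $$ (a, b) = X $$ (a, b) * l + (if 0 < b then X $$ (a, b - 1) else 0)"
proof -
  have "(X * jordan_block k l) $$ (a, b) = (\<Sum>p<k. X $$ (a, p) * jordan_block k l $$ (p, b))"
    using assms by (intro mult_mat_index_sum) auto
  \<comment> \<open>For \<open>b = 0\<close> the truncated \<open>b - 1\<close> is 0 and would match
    \<open>p = 0\<close>; the inner test \<open>0 < b\<close> suppresses this term.\<close>
  also have "\<dots> = (\<Sum>p<k. (if p = b then X $$ (a, b) * l else 0)
      + (if p = b - 1 then (if 0 < b then X $$ (a, b - 1) else 0) else 0))"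
    using assms by (intro sum.cong) auto
  also have "\<dots> = X $$ (a, b) * l + (if 0 < b then X $$ (a, b - 1) else 0)"
    using assms by (simp add: sum.distrib)
  finally show ?thesis .
qed

lemma jordan_block_exp_carrier [simp]: "jordan_block_exp k l t \<in> carrier_mat k k"
  by (intro carrier_matI) auto

lemma jordan_block_exp_comm:
  "jordan_block k l * jordan_block_exp k l t = jordan_block_exp k l t * jordan_block k l"
proof (rule eq_matI)
  fix a b assume "a < dim_row (jordan_block_exp k l t * jordan_block k l)"
    "b < dim_col (jordan_block_exp k l t * jordan_block k l)"
  then have "a < k" "b < k" by auto
  then show "(jordan_block k l * jordan_block_exp k l t) $$ (a, b)
      = (jordan_block_exp k l t * jordan_block k l) $$ (a, b)"
    by (simp only: jordan_block_mult_left[OF jordan_block_exp_carrier]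
        jordan_block_mult_right[OF jordan_block_exp_carrier]) (auto simp: jordan_block_exp_def)
qed auto

lemma jordan_matrix_exp_mult:
  "jordan_matrix js * jordan_exp js t = diag_block_mat (map (\<lambda>(k, l). jordan_block k l * jordan_block_exp k l t) js)"
  "jordan_exp js t * jordan_matrix js = diag_block_mat (map (\<lambda>(k, l). jordan_block_exp k l t * jordan_block k l) js)"
  unfolding jordan_matrix_def jordan_exp_def
  by (subst diag_block_mat_mult[where k = fst], auto simp: split_def)+

lemma jordan_exp_comm: "jordan_matrix js * jordan_exp js t = jordan_exp js t * jordan_matrix js"
  by (simp add: jordan_matrix_exp_mult jordan_block_exp_comm)

text \<open>Differentiating the superdiagonal \<open>d\<close> returns \<open>l\<close> times itself
  plus the superdiagonal \<open>d - 1\<close>, the pattern of multiplication by a Jordan block. The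
  factor \<open>s\<close> will be the direction of time.\<close>

lemma jexp_has_vector_derivative:
  "((\<lambda>t. jexp l d (s * t)) has_vector_derivative
     of_real s * (l * jexp l d (s * t) + (if d = 0 then 0 else jexp l (d - 1) (s * t)))) (at t within S)"
proof -
  let ?f = "\<lambda>z. exp (l * (of_real s * z)) * (of_real s * z) ^ d / fact d"
  have "(?f has_field_derivative (of_real s * (l * jexp l d (s * t)
      + (if d = 0 then 0 else jexp l (d - 1) (s * t))))) (at (of_real t))"
  proof (cases d)
    case 0
    then show ?thesis
      by (auto intro!: derivative_eq_intros simp: jexp_def)
  next
    case (Suc d')
    have "(?f has_field_derivative ((exp (l * (of_real s * of_real t)) * (l * of_real s)) * (of_real s * of_real t) ^ d
       + exp (l * (of_real s * of_real t)) * (of_nat d * (of_real s * of_real t) ^ d' * of_real s)) / fact d) (at (of_real t))"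
      unfolding Suc by (rule derivative_eq_intros refl | simp add: mult_ac del: of_nat_Suc fact_Suc power_Suc)+
    also have "((exp (l * (of_real s * of_real t)) * (l * of_real s)) * (of_real s * of_real t) ^ d
       + exp (l * (of_real s * of_real t)) * (of_nat d * (of_real s * of_real t) ^ d' * of_real s)) / fact d
       = of_real s * (l * jexp l d (s * t) + (if d = 0 then 0 else jexp l (d - 1) (s * t)))"
    proof -
      define N where "N = (of_nat d :: complex)"
      have "N \<noteq> 0" unfolding N_def Suc by (rule of_nat_neq_0)
      moreover have "fact d = N * (fact d' :: complex)"
        unfolding N_def Suc by (rule fact_Suc)
      moreover have "d \<noteq> 0" "d - 1 = d'" using Suc by auto
      ultimately show ?thesis
        by (simp add: jexp_def N_def[symmetric] field_simps)
    qed
    finally show ?thesis .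
  qed
  from has_vector_derivative_real_field[OF this] show ?thesis
    by (simp add: jexp_def)
qed

lemma jordan_exp_has_vector_derivative:
  assumes "r < sum_list (map fst js)" "s < sum_list (map fst js)"
  shows "((\<lambda>t. jordan_exp js (x * t) $$ (r, s)) has_vector_derivative
     of_real x * (jordan_matrix js * jordan_exp js (x * t)) $$ (r, s)) (at t within S)"
proof -
  obtain i a where i: "i < length js" "a < fst (js ! i)" "r = j_off js i + a"
    using assms(1) by (rule block_indexE) simp
  obtain j b where j: "j < length js" "b < fst (js ! j)" "s = j_off js j + b"
    using assms(2) by (rule block_indexE) simp
  let ?k = "fst (js ! i)" and ?l = "snd (js ! i)"
  have eq: "(jordan_matrix js * jordan_exp js (x * t)) $$ (r, s)
      = (if i = j then (jordan_block ?k ?l * jordan_block_exp ?k ?l (x * t)) $$ (a, b) else 0)"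
    unfolding jordan_matrix_exp_mult i j
    by (subst diag_block_mat_index[of _ "map fst js"]) (use i j in \<open>auto simp: split_def simp del: index_mult_mat(1)\<close>)
  show ?thesis
  proof (cases "i = j \<and> a \<le> b")
    case True
    then have "(jordan_matrix js * jordan_exp js (x * t)) $$ (r, s)
        = ?l * jexp ?l (b - a) (x * t) + (if b - a = 0 then 0 else jexp ?l (b - a - 1) (x * t))"
      unfolding eq using i j
      by (subst if_P, blast, subst jordan_block_mult_left) (auto simp: jordan_block_exp_def)
    then show ?thesis
      using True i j jexp_has_vector_derivative[of ?l "b - a" x t S]
      by (simp add: jordan_exp_index jordan_block_exp_def del: index_mult_mat(1))
  next
    case False
    then have "(jordan_matrix js * jordan_exp js (x * t)) $$ (r, s) = 0"
      unfolding eq using i j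
      by (cases "i = j", simp_all only: if_True if_False, subst jordan_block_mult_left) (auto simp: jordan_block_exp_def)
    moreover have "(\<lambda>t. jordan_exp js (x * t) $$ (r, s)) = (\<lambda>t. 0)"
      using False i j by (cases "i = j") (auto simp: jordan_exp_index jordan_block_exp_def)
    ultimately show ?thesis by simp
  qed
qed

lemma continuous_on_jordan_exp:
  assumes "r < sum_list (map fst js)" "s < sum_list (map fst js)"
  shows "continuous_on S (\<lambda>t. jordan_exp js (x * t) $$ (r, s))"
  by (intro continuous_on_vector_derivative) (rule jordan_exp_has_vector_derivative[OF assms])

lemma jexp_tendsto_0:
  fixes s :: real
  assumes "s * Re l < 0"
  shows "((\<lambda>t. jexp l d (s * t)) \<longlongrightarrow> 0) at_top"
proof -
  have eq: "jexp l d (s * t) = of_real s ^ d / fact d * (of_real t ^ d * exp (of_real s * l * of_real t))" for t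
    by (simp add: jexp_def power_mult_distrib mult_ac)
  have "((\<lambda>t. of_real s ^ d / fact d * (of_real t ^ d * exp (of_real s * l * of_real t)))
      \<longlongrightarrow> of_real s ^ d / fact d * 0) at_top"
    using assms by (intro tendsto_intros tendsto_power_mult_exp_complex) simp
  then show ?thesis unfolding eq by simp
qed

section \<open>Lyapunov equations\<close>

text \<open>Since \<open>E\<close> solves \<open>E' = F E = E F\<close>, the derivative of \<open>E X E\<^sup>*\<close> is both
  \<open>F (E X E\<^sup>*) + (E X E\<^sup>*) F\<^sup>*\<close> and \<open>E (F X + X F\<^sup>*) E\<^sup>*\<close>: integrating the first form
  yields existence, the second one uniqueness.\<close>

lemma lyap_solution_integral:
  fixes E :: "real \<Rightarrow> complex mat"
  assumes F: "F \<in> carrier_mat n n" and G: "G \<in> carrier_mat n n"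
    and E: "\<And>t. E t \<in> carrier_mat n n" and E0: "E 0 = 1\<^sub>m n"
    and der: "\<And>i j t. i < n \<Longrightarrow> j < n \<Longrightarrow>
      ((\<lambda>t. E t $$ (i, j)) has_vector_derivative (F * E t) $$ (i, j)) (at t)"
    and comm: "\<And>t. F * E t = E t * F"
    and lim0: "\<And>i j. i < n \<Longrightarrow> j < n \<Longrightarrow> ((\<lambda>t. E t $$ (i, j)) \<longlongrightarrow> 0) at_top"
    and conv: "\<And>i j. i < n \<Longrightarrow> j < n \<Longrightarrow>
      \<exists>L. ((\<lambda>T. integral {0..T} (\<lambda>t. (E t * G * mat_adjoint (E t)) $$ (i, j))) \<longlongrightarrow> L) at_top"
  shows "lyap_solution F G \<in> carrier_mat n n"
    and "\<And>i j. i < n \<Longrightarrow> j < n \<Longrightarrow>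
      ((\<lambda>T. integral {0..T} (\<lambda>t. (E t * G * mat_adjoint (E t)) $$ (i, j)))
        \<longlongrightarrow> lyap_solution F G $$ (i, j)) at_top"
proof -
  define M where "M X t = E t * X * mat_adjoint (E t)" for X t
  have MC: "M X t \<in> carrier_mat n n" if "X \<in> carrier_mat n n" for X t
    using that E[of t] by (auto simp: M_def)
  have FE: "F * E t \<in> carrier_mat n n" for t using F E[of t] by auto
  have M0: "M X 0 = X" if "X \<in> carrier_mat n n" for X
  proof -
    have "mat_adjoint (1\<^sub>m n :: complex mat) = 1\<^sub>m n"
      by (intro eq_matI) (auto simp: mat_adjoint_index)
    then show ?thesis using that by (simp add: M_def E0)
  qed
  have M_index: "M X t $$ (i, j) = (\<Sum>p<n. \<Sum>q<n. E t $$ (i, p) * X $$ (p, q) * cnj (E t $$ (j, q)))"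
    if "X \<in> carrier_mat n n" "i < n" "j < n" for X t i j
    unfolding M_def using that E[of t] by (intro sandwich_index) auto
  have M_lim: "((\<lambda>t. M X t $$ (i, j)) \<longlongrightarrow> 0) at_top"
    if X: "X \<in> carrier_mat n n" and ij: "i < n" "j < n" for X i j
  proof -
    have "((\<lambda>t. \<Sum>p<n. \<Sum>q<n. E t $$ (i, p) * X $$ (p, q) * cnj (E t $$ (j, q)))
       \<longlongrightarrow> (\<Sum>p<n. \<Sum>q<n. 0 * X $$ (p, q) * cnj 0)) at_top"
      using ij by (intro tendsto_sum tendsto_mult tendsto_cnj tendsto_const lim0) auto
    then show ?thesis using M_index[OF that] by simp
  qed
  have M_der: "((\<lambda>t. M X t $$ (i, j)) has_vector_derivative
      (F * E t * X * mat_adjoint (E t) + E t * X * mat_adjoint (F * E t)) $$ (i, j)) (at t within S)"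
    if X: "X \<in> carrier_mat n n" and ij: "i < n" "j < n" for X t i j S
  proof -
    have "((\<lambda>t. \<Sum>p<n. \<Sum>q<n. E t $$ (i, p) * X $$ (p, q) * cnj (E t $$ (j, q)))
       has_vector_derivative (\<Sum>p<n. \<Sum>q<n. E t $$ (i, p) * X $$ (p, q) * cnj ((F * E t) $$ (j, q))
         + ((F * E t) $$ (i, p) * X $$ (p, q)) * cnj (E t $$ (j, q)))) (at t within S)"
      using ij by (intro has_vector_derivative_sum has_vector_derivative_mult has_vector_derivative_mult_left
          has_vector_derivative_cnj has_vector_derivative_at_within[OF der]) auto
    also have "(\<Sum>p<n. \<Sum>q<n. E t $$ (i, p) * X $$ (p, q) * cnj ((F * E t) $$ (j, q))
         + ((F * E t) $$ (i, p) * X $$ (p, q)) * cnj (E t $$ (j, q)))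
       = (F * E t * X * mat_adjoint (E t)) $$ (i, j) + (E t * X * mat_adjoint (F * E t)) $$ (i, j)"
      unfolding sandwich_index[OF FE X E ij] sandwich_index[OF E X FE ij]
      by (simp only: sum.distrib add.commute)
    also have "\<dots> = (F * E t * X * mat_adjoint (E t) + E t * X * mat_adjoint (F * E t)) $$ (i, j)"
      using ij by (simp only: index_add_mat(1) index_mult_mat(2,3) mat_adjoint_dim
          carrier_matD[OF E[of t]] carrier_matD[OF F])
    finally show ?thesis by (simp only: M_index[OF that])
  qed
  have der1: "F * E t * X * mat_adjoint (E t) + E t * X * mat_adjoint (F * E t)
      = F * M X t + M X t * mat_adjoint F" if X: "X \<in> carrier_mat n n" for X t
  proof -
    have "F * E t * X * mat_adjoint (E t) = F * M X t"
      unfolding M_def using F E[of t] X by (simp add: assoc_mult_mat[of _ n n _ n _ n] mult_carrier_mat[of _ n n _ n])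
    moreover have "E t * X * mat_adjoint (F * E t) = M X t * mat_adjoint F"
      unfolding M_def mat_adjoint_mult[OF F E] using F E[of t] X
      by (simp add: assoc_mult_mat[of _ n n _ n _ n] mult_carrier_mat[of _ n n _ n])
    ultimately show ?thesis by simp
  qed
  have der2: "F * E t * X * mat_adjoint (E t) + E t * X * mat_adjoint (F * E t)
      = E t * (F * X + X * mat_adjoint F) * mat_adjoint (E t)" if X: "X \<in> carrier_mat n n" for X t
  proof -
    have "F * E t * X * mat_adjoint (E t) = E t * (F * X) * mat_adjoint (E t)"
      unfolding comm using F E[of t] X by (simp add: assoc_mult_mat[of _ n n _ n _ n] mult_carrier_mat[of _ n n _ n])
    moreover have "E t * X * mat_adjoint (F * E t) = E t * (X * mat_adjoint F) * mat_adjoint (E t)"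
      unfolding comm mat_adjoint_mult[OF E F] using F E[of t] X
      by (simp add: assoc_mult_mat[of _ n n _ n _ n] mult_carrier_mat[of _ n n _ n])
    ultimately show ?thesis
      using F E[of t] X
      by (simp add: mult_add_distrib_mat[of _ n n _ n] add_mult_distrib_mat[of _ n n _ _ n]
          mult_carrier_mat[of _ n n _ n])
  qed

  have unique: "X = 0\<^sub>m n n"
    if X: "X \<in> carrier_mat n n" and eq: "F * X + X * mat_adjoint F = 0\<^sub>m n n" for X
  proof (rule eq_matI)
    fix i j assume "i < dim_row (0\<^sub>m n n :: complex mat)" "j < dim_col (0\<^sub>m n n :: complex mat)"
    then have ij: "i < n" "j < n" by auto
    have "E t * (0\<^sub>m n n) * mat_adjoint (E t) = 0\<^sub>m n n" for t
      using E[of t] right_mult_zero_mat[OF E[of t], of n] left_mult_zero_mat[of "mat_adjoint (E t)" n n n] by auto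
    then have M': "((\<lambda>t. M X t $$ (i, j)) has_vector_derivative 0) (at t within UNIV)" for t
      using M_der[OF X ij, of t UNIV] ij by (simp only: der2[OF X] eq) simp
    \<comment> \<open>The constant must equal the limit 0, and at time 0 it is the entry of
      \<open>X\<close>.\<close>
    obtain c where c: "\<And>t. t \<in> UNIV \<Longrightarrow> M X t $$ (i, j) = c"
      using has_vector_derivative_zero_constant[OF convex_UNIV M'] by blast
    then have "c = 0" using M_lim[OF X ij] by (simp add: tendsto_const_iff)
    then show "X $$ (i, j) = 0\<^sub>m n n $$ (i, j)"
      using c[of 0] M0[OF X] ij by simp
  qed (use X in auto)

  \<comment> \<open>The limits that exist by \<open>conv\<close>, collected in a matrix, are the
    candidate solution.\<close>
  define L where "L i j = Lim at_top (\<lambda>T. integral {0..T} (\<lambda>t. M G t $$ (i, j)))" for i j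
  define X where "X = Matrix.mat n n (\<lambda>(i, j). L i j)"
  have X: "X \<in> carrier_mat n n" by (simp add: X_def)
  have int_lim: "((\<lambda>T. integral {0..T} (\<lambda>t. M G t $$ (i, j))) \<longlongrightarrow> X $$ (i, j)) at_top"
    if ij: "i < n" "j < n" for i j
  proof -
    obtain l where l: "((\<lambda>T. integral {0..T} (\<lambda>t. M G t $$ (i, j))) \<longlongrightarrow> l) at_top"
      using conv[OF ij] unfolding M_def by blast
    then have "L i j = l" unfolding L_def by (intro tendsto_Lim) auto
    with l ij show ?thesis by (simp add: X_def)
  qed
  have intM: "(\<lambda>t. M G t $$ (i, j)) integrable_on {0..T}" if ij: "i < n" "j < n" for i j T
    by (intro integrable_continuous_real continuous_on_vector_derivative) (rule M_der[OF G ij])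
  have solves: "F * X + X * mat_adjoint F + G = 0\<^sub>m n n"
  proof (rule eq_matI)
    fix i j assume "i < dim_row (0\<^sub>m n n :: complex mat)" "j < dim_col (0\<^sub>m n n :: complex mat)"
    then have ij: "i < n" "j < n" by auto
    have lyap_index: "(F * Y + Y * mat_adjoint F) $$ (i, j)
        = (\<Sum>p<n. F $$ (i, p) * Y $$ (p, j)) + (\<Sum>p<n. Y $$ (i, p) * cnj (F $$ (j, p)))"
      if Y: "Y \<in> carrier_mat n n" for Y
    proof -
      have "(F * Y + Y * mat_adjoint F) $$ (i, j) = (F * Y) $$ (i, j) + (Y * mat_adjoint F) $$ (i, j)"
        using F Y ij by (intro index_add_mat(1)) auto
      also have "(F * Y) $$ (i, j) = (\<Sum>p<n. F $$ (i, p) * Y $$ (p, j))"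
        using F Y ij by (rule mult_mat_index_sum)
      also have "(Y * mat_adjoint F) $$ (i, j) = (\<Sum>p<n. Y $$ (i, p) * mat_adjoint F $$ (p, j))"
        using F Y ij by (intro mult_mat_index_sum) auto
      also have "\<dots> = (\<Sum>p<n. Y $$ (i, p) * cnj (F $$ (j, p)))"
        using F ij by (intro sum.cong) (auto simp: mat_adjoint_index)
      finally show ?thesis .
    qed
    have "((\<lambda>T. (\<Sum>p<n. F $$ (i, p) * integral {0..T} (\<lambda>t. M G t $$ (p, j)))
          + (\<Sum>p<n. integral {0..T} (\<lambda>t. M G t $$ (i, p)) * cnj (F $$ (j, p))))
        \<longlongrightarrow> (F * X + X * mat_adjoint F) $$ (i, j)) at_top"
      unfolding lyap_index[OF X] using ij by (intro tendsto_intros int_lim) auto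
    moreover have "\<forall>\<^sub>F T in at_top. (\<Sum>p<n. F $$ (i, p) * integral {0..T} (\<lambda>t. M G t $$ (p, j)))
          + (\<Sum>p<n. integral {0..T} (\<lambda>t. M G t $$ (i, p)) * cnj (F $$ (j, p)))
        = M G T $$ (i, j) - G $$ (i, j)"
      using eventually_ge_at_top[of 0]
    proof eventually_elim
      case (elim T)
      \<comment> \<open>The same integral is computed twice: from its endpoint values, and by
        linearity from the integrals of the entries of \<open>M G\<close>.\<close>
      have "((\<lambda>t. (F * M G t + M G t * mat_adjoint F) $$ (i, j)) has_integral M G T $$ (i, j) - M G 0 $$ (i, j)) {0..T}"
        using M_der[OF G ij] unfolding der1[OF G] by (intro fundamental_theorem_of_calculus elim)
      moreover have "((\<lambda>t. (F * M G t + M G t * mat_adjoint F) $$ (i, j)) has_integral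
          (\<Sum>p<n. F $$ (i, p) * integral {0..T} (\<lambda>t. M G t $$ (p, j)))
          + (\<Sum>p<n. integral {0..T} (\<lambda>t. M G t $$ (i, p)) * cnj (F $$ (j, p)))) {0..T}"
        unfolding lyap_index[OF MC[OF G]] using ij
        by (intro has_integral_add has_integral_sum has_integral_mult_right has_integral_mult_left
            integrable_integral intM) auto
      ultimately show ?case
        unfolding M0[OF G] using has_integral_unique by blast
    qed
    ultimately have "((\<lambda>T. M G T $$ (i, j) - G $$ (i, j)) \<longlongrightarrow> (F * X + X * mat_adjoint F) $$ (i, j)) at_top"
      by (rule Lim_transform_eventually)
    \<comment> \<open>Since \<open>M G T\<close> decays, the limit is also \<open>- G\<close>;
      comparing the two limits gives the equation.\<close>
    moreover have "((\<lambda>T. M G T $$ (i, j) - G $$ (i, j)) \<longlongrightarrow> 0 - G $$ (i, j)) at_top"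
      by (intro tendsto_intros M_lim G ij)
    ultimately have "(F * X + X * mat_adjoint F) $$ (i, j) = 0 - G $$ (i, j)"
      by (rule tendsto_unique[rotated]) simp
    then show "(F * X + X * mat_adjoint F + G) $$ (i, j) = 0\<^sub>m n n $$ (i, j)"
      using F X G ij by (simp del: index_mult_mat(1) index_add_mat(1) add: index_add_mat(1)[of _ G])
  qed (use F X G in auto)

  have "lyap_solution F G = X"
    unfolding lyap_solution_def
  proof (rule the_equality)
    show "X \<in> carrier_mat (dim_row F) (dim_row F) \<and> F * X + X * mat_adjoint F + G = 0\<^sub>m (dim_row F) (dim_row F)"
      using X F solves by simp
    fix Y assume "Y \<in> carrier_mat (dim_row F) (dim_row F) \<and>
      F * Y + Y * mat_adjoint F + G = 0\<^sub>m (dim_row F) (dim_row F)"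
    then have Y: "Y \<in> carrier_mat n n" and Y_eq: "F * Y + Y * mat_adjoint F + G = 0\<^sub>m n n"
      using F by auto
    have XY: "Y - X \<in> carrier_mat n n" using X Y by auto
    \<comment> \<open>The difference of two solutions solves the homogeneous equation.\<close>
    have "F * (Y - X) + (Y - X) * mat_adjoint F = 0\<^sub>m n n"
    proof (rule eq_matI)
      fix i j assume "i < dim_row (0\<^sub>m n n :: complex mat)" "j < dim_col (0\<^sub>m n n :: complex mat)"
      then have ij: "i < n" "j < n" by auto
      have "F * (Y - X) = F * Y - F * X" using F X Y by (intro mult_minus_distrib_mat) auto
      moreover have "(Y - X) * mat_adjoint F = Y * mat_adjoint F - X * mat_adjoint F"
        using F X Y by (intro minus_mult_distrib_mat) auto
      ultimately have "(F * (Y - X) + (Y - X) * mat_adjoint F) $$ (i, j)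
          = (F * Y + Y * mat_adjoint F + G) $$ (i, j) - (F * X + X * mat_adjoint F + G) $$ (i, j)"
        using F X Y G ij by (simp del: index_mult_mat(1))
      then show "(F * (Y - X) + (Y - X) * mat_adjoint F) $$ (i, j) = 0\<^sub>m n n $$ (i, j)"
        using ij by (simp only: Y_eq solves) simp
    qed (use F X Y in auto)
    from unique[OF XY this] have 0: "Y - X = 0\<^sub>m n n" .
    show "Y = X"
    proof (rule eq_matI)
      fix i j assume "i < dim_row X" "j < dim_col X"
      then show "Y $$ (i, j) = X $$ (i, j)"
        using arg_cong[OF 0, of "\<lambda>Z. Z $$ (i, j)"] X Y by simp
    qed (use X Y in auto)
  qed
  then show "lyap_solution F G \<in> carrier_mat n n"
    and "\<And>i j. i < n \<Longrightarrow> j < n \<Longrightarrow>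
      ((\<lambda>T. integral {0..T} (\<lambda>t. (E t * G * mat_adjoint (E t)) $$ (i, j)))
        \<longlongrightarrow> lyap_solution F G $$ (i, j)) at_top"
    using X int_lim by (auto simp: M_def)
qed

text \<open>The case \<open>x = 1\<close> serves the stable section. The case \<open>x = - 1\<close>
  serves the negative of the antistable Jordan matrix, whose exponential is
  \<open>jordan_exp js (- t)\<close>.\<close>

lemma jordan_lyap_solution:
  fixes x :: real
  assumes x: "x = 1 \<or> x = - 1" and neg: "\<And>k l. (k, l) \<in> set js \<Longrightarrow> x * Re l < 0"
    and K: "K \<in> carrier_mat (sum_list (map fst js)) (sum_list (map fst js))"
  shows "lyap_solution (of_real x \<cdot>\<^sub>m jordan_matrix js) K \<in> carrier_mat (sum_list (map fst js)) (sum_list (map fst js))"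
    and "\<And>r s. r < sum_list (map fst js) \<Longrightarrow> s < sum_list (map fst js) \<Longrightarrow>
      ((\<lambda>T. integral {0..T} (\<lambda>t. (jordan_exp js (x * t) * K * mat_adjoint (jordan_exp js (x * t))) $$ (r, s)))
        \<longlongrightarrow> lyap_solution (of_real x \<cdot>\<^sub>m jordan_matrix js) K $$ (r, s)) at_top"
proof -
  let ?n = "sum_list (map fst js)" and ?F = "of_real x \<cdot>\<^sub>m jordan_matrix js"
  have F: "?F \<in> carrier_mat ?n ?n" by simp
  have FE: "?F * jordan_exp js t = of_real x \<cdot>\<^sub>m (jordan_matrix js * jordan_exp js t)" for t
    by (rule mult_smult_assoc_mat) (auto intro: jordan_matrix_carrier)
  have comm: "?F * jordan_exp js t = jordan_exp js t * ?F" for t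
    unfolding FE jordan_exp_comm
    by (rule mult_smult_distrib[symmetric]) (auto intro: jordan_matrix_carrier)
  have der: "((\<lambda>t. jordan_exp js (x * t) $$ (i, j)) has_vector_derivative (?F * jordan_exp js (x * t)) $$ (i, j)) (at t)"
    if "i < ?n" "j < ?n" for i j t
    using jordan_exp_has_vector_derivative[OF that, of x t UNIV] that
    by (simp add: FE del: index_mult_mat(1))
  have lim0: "((\<lambda>t. jordan_exp js (x * t) $$ (i, j)) \<longlongrightarrow> 0) at_top"
    if ij: "i < ?n" "j < ?n" for i j
    using jordan_exp_index_cases[OF ij] by cases (use neg in \<open>auto intro: jexp_tendsto_0\<close>)
  have conv: "\<exists>L. ((\<lambda>T. integral {0..T} (\<lambda>t. (jordan_exp js (x * t) * K * mat_adjoint (jordan_exp js (x * t))) $$ (i, j)))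
      \<longlongrightarrow> L) at_top" if ij: "i < ?n" "j < ?n" for i j
  proof -
    let ?g = "\<lambda>p q t. jordan_exp js (x * t) $$ (i, p) * cnj (jordan_exp js (x * t) $$ (j, q))"
    have ex: "\<exists>L. ((\<lambda>T. integral {0..T} (?g p q)) \<longlongrightarrow> L) at_top" if pq: "p < ?n" "q < ?n" for p q
      using jordan_exp_index_cases[OF ij(1) pq(1)]
    proof cases
      case 1
      then show ?thesis by auto
    next
      case (2 k l d)
      note kl = this
      show ?thesis
        using jordan_exp_index_cases[OF ij(2) pq(2)]
      proof cases
        case 1
        then show ?thesis by auto
      next
        case (2 k' l' d')
        then show ?thesis
          using jexp_integral_convergent[OF x, of l l' d d'] neg kl by auto
      qed
    qed
    define L where "L p q = Lim at_top (\<lambda>T. integral {0..T} (?g p q))" for p q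
    have L: "((\<lambda>T. integral {0..T} (?g p q)) \<longlongrightarrow> L p q) at_top" if pq: "p < ?n" "q < ?n" for p q
    proof -
      obtain l where l: "((\<lambda>T. integral {0..T} (?g p q)) \<longlongrightarrow> l) at_top"
        using ex[OF pq] by blast
      then have "L p q = l" unfolding L_def by (intro tendsto_Lim) auto
      with l show ?thesis by simp
    qed
    have "integral {0..T} (\<lambda>t. (jordan_exp js (x * t) * K * mat_adjoint (jordan_exp js (x * t))) $$ (i, j))
        = (\<Sum>p<?n. \<Sum>q<?n. K $$ (p, q) * integral {0..T} (?g p q))" for T
    proof (rule integral_unique)
      have "((\<lambda>t. \<Sum>p<?n. \<Sum>q<?n. K $$ (p, q) * ?g p q t) has_integral
          (\<Sum>p<?n. \<Sum>q<?n. K $$ (p, q) * integral {0..T} (?g p q))) {0..T}"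
        using ij by (intro has_integral_sum has_integral_mult_right integrable_integral integrable_continuous_real
            continuous_intros continuous_on_jordan_exp) auto
      then show "((\<lambda>t. (jordan_exp js (x * t) * K * mat_adjoint (jordan_exp js (x * t))) $$ (i, j)) has_integral
          (\<Sum>p<?n. \<Sum>q<?n. K $$ (p, q) * integral {0..T} (?g p q))) {0..T}"
        unfolding sandwich_index[OF jordan_exp_carrier K jordan_exp_carrier ij] by (simp add: mult_ac)
    qed
    moreover have "((\<lambda>T. \<Sum>p<?n. \<Sum>q<?n. K $$ (p, q) * integral {0..T} (?g p q))
        \<longlongrightarrow> (\<Sum>p<?n. \<Sum>q<?n. K $$ (p, q) * L p q)) at_top"
      by (intro tendsto_intros L) auto
    ultimately show ?thesis by auto
  qed
  have E0: "jordan_exp js (x * 0) = 1\<^sub>m ?n" by (simp add: jordan_exp_0)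
  note * = lyap_solution_integral[where E = "\<lambda>t. jordan_exp js (x * t)",
      OF F K jordan_exp_carrier E0 der comm lim0 conv]
  show "lyap_solution ?F K \<in> carrier_mat ?n ?n" using *(1) by blast
  show "((\<lambda>T. integral {0..T} (\<lambda>t. (jordan_exp js (x * t) * K * mat_adjoint (jordan_exp js (x * t))) $$ (r, s)))
        \<longlongrightarrow> lyap_solution ?F K $$ (r, s)) at_top" if "r < ?n" "s < ?n" for r s
    by (rule *(2)) (assumption | rule that)+
qed

section \<open>The scaled Gramian as an integral\<close>

text \<open>The binomial theorem. It yields the semigroup law for a Jordan block, which inverts the
  antistable scaling and shifts its time to \<open>t - T\<close>.\<close>

lemma jexp_add: "jexp l d (s + t) = (\<Sum>i\<le>d. jexp l i s * jexp l (d - i) t)"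
proof -
  have binomial: "(of_real s + of_real t) ^ d / fact d
      = (\<Sum>i\<le>d. (of_real s ^ i / fact i) * (of_real t ^ (d - i) / fact (d - i)) :: complex)"
    unfolding binomial_ring sum_divide_distrib
    by (intro sum.cong refl) (simp add: binomial_fact)
  have "jexp l d (s + t) = exp (l * of_real s) * exp (l * of_real t) * ((of_real s + of_real t) ^ d / fact d)"
    by (simp add: jexp_def distrib_left exp_add)
  then show ?thesis
    unfolding binomial by (simp add: jexp_def sum_distrib_left mult_ac)
qed

lemma jordan_block_exp_add:
  "jordan_block_exp k l s * jordan_block_exp k l t = jordan_block_exp k l (s + t)"
proof (rule eq_matI)
  fix a b assume "a < dim_row (jordan_block_exp k l (s + t))" "b < dim_col (jordan_block_exp k l (s + t))"
  then have ab: "a < k" "b < k" by auto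
  have "(jordan_block_exp k l s * jordan_block_exp k l t) $$ (a, b)
      = (\<Sum>c<k. jordan_block_exp k l s $$ (a, c) * jordan_block_exp k l t $$ (c, b))"
    using ab by (intro mult_mat_index_sum) auto
  also have "\<dots> = (\<Sum>c<k. if a \<le> c \<and> c \<le> b then jexp l (c - a) s * jexp l (b - c) t else 0)"
    using ab by (intro sum.cong) (auto simp: jordan_block_exp_def)
  also have "\<dots> = (\<Sum>c\<in>{a..b}. jexp l (c - a) s * jexp l (b - c) t)"
    using ab by (intro sum.mono_neutral_cong_right) auto
  also have "\<dots> = jordan_block_exp k l (s + t) $$ (a, b)"
  proof (cases "a \<le> b")
    case True
    have "(\<Sum>c\<in>{a..b}. jexp l (c - a) s * jexp l (b - c) t) = (\<Sum>i\<le>b - a. jexp l i s * jexp l (b - a - i) t)"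
      by (rule sum.reindex_bij_witness[of _ "\<lambda>i. i + a" "\<lambda>c. c - a"]) (use True in auto)
    then show ?thesis using True ab by (simp add: jordan_block_exp_def jexp_add)
  qed (use ab in \<open>simp add: jordan_block_exp_def\<close>)
  finally show "(jordan_block_exp k l s * jordan_block_exp k l t) $$ (a, b) = jordan_block_exp k l (s + t) $$ (a, b)" .
qed auto

lemma jordan_block_exp_0: "jordan_block_exp k l 0 = 1\<^sub>m k"
  by (intro eq_matI) (auto simp: jordan_block_exp_def jexp_0)

text \<open>Explicit inverses of the diagonal blocks of \<open>scal_mat\<close> for positive
  \<open>T\<close>; on an antistable block this is the exponential at time
  \<open>- T\<close>.\<close>

definition scal_inv_block :: "(nat \<times> complex) list \<Rightarrow> real \<Rightarrow> nat \<Rightarrow> complex mat" where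
  "scal_inv_block js T i = (let (k, l) = js ! i in
     if i < m_neg js then 1\<^sub>m k
     else if i < m_neg js + m_zero js then
       mat_diag k (\<lambda>a. complex_of_real (T powr - (real k - real a - 1/2)))
     else jordan_block_exp k l (- T))"

text \<open>A block of the inverse scaling times the exponential. Row \<open>a\<close>, counted from
  0, has \<open>k - Suc a\<close> rows below it.\<close>

definition kern_block :: "real \<Rightarrow> real \<Rightarrow> nat \<times> complex \<Rightarrow> complex mat" where
  "kern_block T t = (\<lambda>(k, l). Matrix.mat k k
     (\<lambda>(a, c). if a \<le> c then kern l (k - Suc a) (c - a) T t else 0))"

definition kern_mat :: "(nat \<times> complex) list \<Rightarrow> real \<Rightarrow> real \<Rightarrow> complex mat" where
  "kern_mat js T t = diag_block_mat (map (kern_block T t) js)"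

lemma kern_block_dims:
  "map dim_row (map (kern_block T t) js) = map fst js"
  "map dim_col (map (kern_block T t) js) = map fst js"
  by (auto simp: kern_block_def split_def)

lemma kern_mat_carrier: "kern_mat js T t \<in> carrier_mat (sum_list (map fst js)) (sum_list (map fst js))"
  unfolding kern_mat_def by (rule diag_block_mat_carrier[OF kern_block_dims])

lemma scal_block_carrier:
  "scal_block js T i \<in> carrier_mat (fst (js ! i)) (fst (js ! i))"
  "scal_inv_block js T i \<in> carrier_mat (fst (js ! i)) (fst (js ! i))"
  by (auto simp: scal_block_def scal_inv_block_def Let_def split_def mat_exp_eqI[OF exp_sums_jordan_block])

text \<open>Positivity of \<open>T\<close> enters through the powers, since \<open>0 powr x\<close>
  is 0.\<close>

lemma scal_block_inverse:
  assumes "0 < T"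
  shows "scal_block js T i * scal_inv_block js T i = 1\<^sub>m (fst (js ! i))"
    and "scal_inv_block js T i * scal_block js T i = 1\<^sub>m (fst (js ! i))"
proof -
  have 1: "of_real (T powr x) * of_real (T powr - x) = (1 :: complex)"
    "of_real (T powr - x) * of_real (T powr x) = (1 :: complex)" for x
    using assms by (simp_all flip: of_real_mult powr_add)
  show "scal_block js T i * scal_inv_block js T i = 1\<^sub>m (fst (js ! i))"
    "scal_inv_block js T i * scal_block js T i = 1\<^sub>m (fst (js ! i))"
    unfolding scal_block_def scal_inv_block_def Let_def split_def mat_exp_eqI[OF exp_sums_jordan_block]
    by (cases "i < m_neg js"; cases "i < m_neg js + m_zero js";
        simp only: jordan_block_exp_add mat_diag_diag 1 mat_diag_one if_True if_False add.right_inverse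
          add.left_inverse jordan_block_exp_0 left_mult_one_mat[OF one_carrier_mat])+
qed

lemma map_nth_fun: "map (\<lambda>i. f (xs ! i)) [0..<length xs] = map f xs"
  by (rule nth_equalityI) auto

lemma mat_inv_scal_mat:
  assumes "0 < T"
  shows "mat_inv (scal_mat js T) = diag_block_mat (map (scal_inv_block js T) [0..<length js])"
proof (rule mat_inv_eqI)
  let ?n = "sum_list (map fst js)" and ?I = "[0..<length js]"
  have one: "diag_block_mat (map (\<lambda>i. 1\<^sub>m (fst (js ! i))) ?I) = (1\<^sub>m ?n :: complex mat)"
    using diag_block_one_mat[of "map (\<lambda>i. 1\<^sub>m (fst (js ! i)) :: complex mat) ?I"]
    by (simp add: comp_def map_nth_fun del: diag_block_one_mat)
  have dims: "map dim_row (map f ?I) = map fst js" "map dim_col (map f ?I) = map fst js"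
    if "\<And>i. f i \<in> carrier_mat (fst (js ! i)) (fst (js ! i))" for f :: "nat \<Rightarrow> complex mat"
    using carrier_matD[OF that] by (simp_all add: comp_def map_nth_fun)
  show "scal_mat js T \<in> carrier_mat ?n ?n"
    unfolding scal_mat_def by (rule diag_block_mat_carrier[OF dims[of "scal_block js T", OF scal_block_carrier(1)]])
  show "diag_block_mat (map (scal_inv_block js T) ?I) \<in> carrier_mat ?n ?n"
    by (rule diag_block_mat_carrier[OF dims[of "scal_inv_block js T", OF scal_block_carrier(2)]])
  show "diag_block_mat (map (scal_inv_block js T) ?I) * scal_mat js T = 1\<^sub>m ?n"
    unfolding scal_mat_def diag_block_mat_mult[OF scal_block_carrier(2) scal_block_carrier(1)]
    by (simp only: scal_block_inverse[OF assms] one)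
  show "scal_mat js T * diag_block_mat (map (scal_inv_block js T) ?I) = 1\<^sub>m ?n"
    unfolding scal_mat_def diag_block_mat_mult[OF scal_block_carrier(1) scal_block_carrier(2)]
    by (simp only: scal_block_inverse[OF assms] one)
qed

text \<open>Here the ordering of the blocks enters: the scaling is chosen by the position
  \<open>i\<close>, the kernel by the sign of the real part, and \<open>jordan_ordered\<close> makes
  the two choices agree.\<close>

lemma scal_inv_block_mult_exp:
  assumes "jordan_ordered js" "i < length js"
  shows "scal_inv_block js T i * jordan_block_exp (fst (js ! i)) (snd (js ! i)) t = kern_block T t (js ! i)"
proof -
  obtain k l where kl: "js ! i = (k, l)" by force
  consider "i < m_neg js" "Re l < 0"
    | "\<not> i < m_neg js" "i < m_neg js + m_zero js" "Re l = 0"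
    | "\<not> i < m_neg js" "\<not> i < m_neg js + m_zero js" "0 < Re l"
    using assms kl unfolding jordan_ordered_def
    by (metis atLeastLessThan_iff not_le snd_conv)
  then show ?thesis
  proof cases
    case 1
    then show ?thesis
      by (intro eq_matI)
        (auto simp: kl scal_inv_block_def kern_block_def kern_def jordan_block_exp_def
          left_mult_one_mat[of _ k k])
  next
    case 2
    \<comment> \<open>The half-integer exponents are rewritten as \<open>(k - Suc a) + 1/2\<close>;
      the truncated subtraction is exact because \<open>a < k\<close>.\<close>
    have "T powr - (real k - real a - 1/2) = T powr (- real (k - Suc a) - 1/2)" if "a < k" for a
      using that by (simp add: of_nat_diff algebra_simps)
    then show ?thesis
      using 2 by (intro eq_matI)
        (auto simp: kl scal_inv_block_def kern_block_def kern_def mat_diag_mult_left[of _ k k] jordan_block_exp_def)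
  next
    case 3
    then have "scal_inv_block js T i * jordan_block_exp (fst (js ! i)) (snd (js ! i)) t = jordan_block_exp k l (t - T)"
      by (simp add: kl scal_inv_block_def jordan_block_exp_add)
    also have "\<dots> = kern_block T t (js ! i)"
      using 3 by (intro eq_matI) (auto simp: kl kern_block_def kern_def jordan_block_exp_def)
    finally show ?thesis .
  qed
qed

lemma scal_inv_mult_jordan_exp:
  assumes "jordan_ordered js" "0 < T"
  shows "mat_inv (scal_mat js T) * jordan_exp js t = kern_mat js T t"
proof -
  have E: "jordan_exp js t
      = diag_block_mat (map (\<lambda>i. jordan_block_exp (fst (js ! i)) (snd (js ! i)) t) [0..<length js])"
    unfolding jordan_exp_def
    using map_nth_fun[of "\<lambda>p. jordan_block_exp (fst p) (snd p) t" js] by (simp add: split_def)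
  have "mat_inv (scal_mat js T) * jordan_exp js t = diag_block_mat (map (\<lambda>i. scal_inv_block js T i *
      jordan_block_exp (fst (js ! i)) (snd (js ! i)) t) [0..<length js])"
    unfolding mat_inv_scal_mat[OF assms(2)] E
    by (rule diag_block_mat_mult[OF scal_block_carrier(2) jordan_block_exp_carrier])
  also have "\<dots> = diag_block_mat (map (\<lambda>i. kern_block T t (js ! i)) [0..<length js])"
    using scal_inv_block_mult_exp[OF assms(1)] by (intro arg_cong[where f = diag_block_mat]) simp
  also have "\<dots> = kern_mat js T t"
    by (simp add: kern_mat_def map_nth_fun)
  finally show ?thesis .
qed

text \<open>Linearity of the integral, entry by entry. Integrability is assumed because
  \<open>integral\<close> takes a default value on functions that are not integrable, and linearity
  could then fail.\<close>

lemma mult_mat_integral_adjoint: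
  assumes U: "U \<in> carrier_mat n n" and M: "\<And>t. M t \<in> carrier_mat n n"
    and int: "\<And>i j. i < n \<Longrightarrow> j < n \<Longrightarrow> (\<lambda>t. M t $$ (i, j)) integrable_on S"
  shows "U * mat_integral n n S M * mat_adjoint U = mat_integral n n S (\<lambda>t. U * M t * mat_adjoint U)"
proof (rule eq_matI)
  fix i j assume "i < dim_row (mat_integral n n S (\<lambda>t. U * M t * mat_adjoint U))"
    "j < dim_col (mat_integral n n S (\<lambda>t. U * M t * mat_adjoint U))"
  then have ij: "i < n" "j < n" by (auto simp: mat_integral_def)
  have C: "mat_integral n n S M \<in> carrier_mat n n" by (simp add: mat_integral_def)
  have "((\<lambda>t. \<Sum>p<n. \<Sum>q<n. U $$ (i, p) * M t $$ (p, q) * cnj (U $$ (j, q))) has_integral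
      (\<Sum>p<n. \<Sum>q<n. U $$ (i, p) * integral S (\<lambda>t. M t $$ (p, q)) * cnj (U $$ (j, q)))) S"
    using ij by (intro has_integral_sum has_integral_mult_left has_integral_mult_right integrable_integral int) auto
  moreover have "(U * mat_integral n n S M * mat_adjoint U) $$ (i, j)
      = (\<Sum>p<n. \<Sum>q<n. U $$ (i, p) * integral S (\<lambda>t. M t $$ (p, q)) * cnj (U $$ (j, q)))"
    unfolding sandwich_index[OF U C U ij]
    by (intro sum.cong refl) (simp add: mat_integral_def)
  moreover have "mat_integral n n S (\<lambda>t. U * M t * mat_adjoint U) $$ (i, j)
      = integral S (\<lambda>t. \<Sum>p<n. \<Sum>q<n. U $$ (i, p) * M t $$ (p, q) * cnj (U $$ (j, q)))"
    using ij by (simp add: mat_integral_def sandwich_index[OF U M U ij] del: index_mult_mat(1))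
  ultimately show "(U * mat_integral n n S M * mat_adjoint U) $$ (i, j)
      = mat_integral n n S (\<lambda>t. U * M t * mat_adjoint U) $$ (i, j)"
    by (simp only: integral_unique)
qed (use U in \<open>auto simp: mat_integral_def\<close>)

lemma sandwich_sandwich:
  fixes U V B :: "complex mat"
  assumes "U \<in> carrier_mat n n" "V \<in> carrier_mat n n" "B \<in> carrier_mat n n"
  shows "U * (V * B * mat_adjoint V) * mat_adjoint U = U * V * B * mat_adjoint (U * V)"
  unfolding mat_adjoint_mult[OF assms(1,2)]
  using assms by (simp add: assoc_mult_mat[of _ n n _ n _ n] mult_carrier_mat[of _ n n _ n])

text \<open>All constant factors move under the integral, where the similarity with the Jordan
  matrix cancels against \<open>mat_inv Q\<close> and only the scaled exponential around
  \<open>B_tilde Q B\<close> remains.\<close>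

lemma scaled_gramian_eq:
  fixes A :: "real mat"
  assumes A: "A \<in> carrier_mat n n" and B: "B \<in> carrier_mat n n" and Q: "Q \<in> carrier_mat n n"
    and inv: "invertible_mat Q" and jf: "mat_inv Q * map_mat complex_of_real A * Q = jordan_matrix js"
    and ord: "jordan_ordered js" and T: "0 < T"
  shows "scaled_gramian (map_mat complex_of_real A) Q js B T
    = mat_integral n n {0..T} (\<lambda>t. kern_mat js T t * B_tilde Q B * mat_adjoint (kern_mat js T t))"
    and "sum_list (map fst js) = n" and "B_tilde Q B \<in> carrier_mat n n"
proof -
  let ?A = "map_mat complex_of_real A" and ?P = "mat_inv Q" and ?J = "jordan_matrix js"
  note P = mat_inv_invertible[OF Q inv]
  have A': "?A \<in> carrier_mat n n" using A by simp
  show n: "sum_list (map fst js) = n"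
    using arg_cong[OF jf, of dim_row] carrier_matD[OF P(1)] by simp
  show Bt: "B_tilde Q B \<in> carrier_mat n n"
    unfolding B_tilde_def using P(1) B by (meson mat_adjoint_carrier mult_carrier_mat)
  have J: "?J \<in> carrier_mat n n" using jordan_matrix_carrier[of js] by (simp only: n)
  have E: "jordan_exp js t \<in> carrier_mat n n" for t using jordan_exp_carrier[of js t] by (simp only: n)
  define V where "V t = Q * jordan_exp js t * ?P" for t
  have V: "V t \<in> carrier_mat n n" for t
    unfolding V_def using Q E P(1) by (meson mult_carrier_mat)
  have A_eq: "?A = Q * ?J * ?P"
  proof -
    have "Q * ?J * ?P = (Q * ?P) * ?A * (Q * ?P)"
      unfolding jf[symmetric] using Q P(1) A'
      by (simp only: assoc_mult_mat[of _ n n _ n _ n] mult_carrier_mat[of _ n n _ n])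
    then show ?thesis using A' by (simp add: P(3) left_mult_one_mat[of _ n n] right_mult_one_mat[of _ n n])
  qed
  have sums: "exp_sums (complex_of_real t \<cdot>\<^sub>m ?A) (V t)" for t
  proof -
    have tJ: "complex_of_real t \<cdot>\<^sub>m ?J \<in> carrier_mat n n" using J by simp
    have "exp_sums (Q * (complex_of_real t \<cdot>\<^sub>m ?J) * ?P) (V t)"
      unfolding V_def by (rule exp_sums_similar[OF tJ Q P(1) P(2,3) exp_sums_jordan_matrix])
    moreover have "Q * (complex_of_real t \<cdot>\<^sub>m ?J) * ?P = complex_of_real t \<cdot>\<^sub>m ?A"
    proof -
      have "Q * (complex_of_real t \<cdot>\<^sub>m ?J) = complex_of_real t \<cdot>\<^sub>m (Q * ?J)"
        by (rule mult_smult_distrib[OF Q J])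
      moreover have "complex_of_real t \<cdot>\<^sub>m (Q * ?J) * ?P = complex_of_real t \<cdot>\<^sub>m (Q * ?J * ?P)"
        by (rule mult_smult_assoc_mat[OF mult_carrier_mat[OF Q J] P(1)])
      ultimately show ?thesis using A_eq by simp
    qed
    ultimately show ?thesis by simp
  qed
  have sums': "exp_sums (complex_of_real t \<cdot>\<^sub>m transpose_mat ?A) (mat_adjoint (V t))" for t
  proof -
    \<comment> \<open>Since \<open>A\<close> has real entries, its transpose is its adjoint; hence
      the right factor of the integrand is the adjoint of the left one.\<close>
    have "complex_of_real t \<cdot>\<^sub>m transpose_mat ?A = mat_adjoint (complex_of_real t \<cdot>\<^sub>m ?A)"
      using A by (intro eq_matI) (auto simp: mat_adjoint_index)
    then show ?thesis
      using exp_sums_adjoint[OF _ sums[of t], where n = n] A' by simp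
  qed
  have gram: "gramian ?A B T = mat_integral n n {0..T} (\<lambda>t. V t * B * mat_adjoint (V t))"
    unfolding gramian_def using A by (simp add: mat_exp_eqI[OF sums] mat_exp_eqI[OF sums'])
  have cont: "continuous_on {0..T} (\<lambda>t. V t $$ (i, j))" if ij: "i < n" "j < n" for i j
  proof -
    have V_index: "V t $$ (i, j) = (\<Sum>q<n. (\<Sum>p<n. Q $$ (i, p) * jordan_exp js (1 * t) $$ (p, q)) * ?P $$ (q, j))" for t
    proof -
      have "V t $$ (i, j) = (\<Sum>q<n. (Q * jordan_exp js t) $$ (i, q) * ?P $$ (q, j))"
        unfolding V_def using mult_carrier_mat[OF Q E] P(1) ij by (rule mult_mat_index_sum)
      also have "\<dots> = (\<Sum>q<n. (\<Sum>p<n. Q $$ (i, p) * jordan_exp js (1 * t) $$ (p, q)) * ?P $$ (q, j))"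
        using ij by (simp add: mult_mat_index_sum[OF Q E] del: index_mult_mat(1))
      finally show ?thesis .
    qed
    show ?thesis
      unfolding V_index by (intro continuous_intros continuous_on_jordan_exp) (auto simp: n)
  qed
  have VBV: "V t * B * mat_adjoint (V t) \<in> carrier_mat n n" for t
    using V B by (meson mat_adjoint_carrier mult_carrier_mat)
  have int: "(\<lambda>t. (V t * B * mat_adjoint (V t)) $$ (i, j)) integrable_on {0..T}" if ij: "i < n" "j < n" for i j
    unfolding sandwich_index[OF V B V ij]
    using ij by (intro integrable_continuous_real continuous_intros cont) auto
  define D where "D = mat_inv (scal_mat js T)"
  have D: "D \<in> carrier_mat n n"
  proof -
    have "map dim_row (map (scal_inv_block js T) [0..<length js]) = map fst js"
      "map dim_col (map (scal_inv_block js T) [0..<length js]) = map fst js"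
      using carrier_matD[OF scal_block_carrier(2)] by (simp_all add: comp_def map_nth_fun)
    from diag_block_mat_carrier[OF this] show ?thesis
      by (simp only: n mat_inv_scal_mat[OF T] D_def)
  qed
  have DP: "D * ?P \<in> carrier_mat n n" using D P(1) by (rule mult_carrier_mat)
  have G: "gramian ?A B T \<in> carrier_mat n n" unfolding gram by (simp add: mat_integral_def)
  \<comment> \<open>The inverse scaling and \<open>mat_inv Q\<close> form one left factor, and the
    two adjoints on the right form its adjoint.\<close>
  have "scaled_gramian ?A Q js B T = D * ?P * gramian ?A B T * mat_adjoint (D * ?P)"
    unfolding scaled_gramian_def D_def[symmetric] mat_adjoint_mult[OF D P(1)]
    using D P(1) G
    by (simp add: assoc_mult_mat[of _ n n _ n _ n] mult_carrier_mat[of _ n n _ n])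
  also have "\<dots> = mat_integral n n {0..T} (\<lambda>t. D * ?P * (V t * B * mat_adjoint (V t)) * mat_adjoint (D * ?P))"
    unfolding gram by (rule mult_mat_integral_adjoint[OF DP VBV int])
  also have "(\<lambda>t. D * ?P * (V t * B * mat_adjoint (V t)) * mat_adjoint (D * ?P))
      = (\<lambda>t. kern_mat js T t * B_tilde Q B * mat_adjoint (kern_mat js T t))"
  proof
    fix t
    have K: "kern_mat js T t \<in> carrier_mat n n" using kern_mat_carrier[of js T t] by (simp only: n)
    \<comment> \<open>Once \<open>?P * Q\<close> is removed, the inverse scaling meets the
      exponential directly.\<close>
    have "D * ?P * V t = D * ((?P * Q) * jordan_exp js t) * ?P"
      unfolding V_def using D P(1) Q E[of t]
      by (simp only: assoc_mult_mat[of _ n n _ n _ n] mult_carrier_mat[of _ n n _ n])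
    also have "\<dots> = kern_mat js T t * ?P"
      using E[of t] scal_inv_mult_jordan_exp[OF ord T]
      by (simp add: P(2) left_mult_one_mat[of _ n n] D_def)
    finally have DPV: "D * ?P * V t = kern_mat js T t * ?P" .
    show "D * ?P * (V t * B * mat_adjoint (V t)) * mat_adjoint (D * ?P)
        = kern_mat js T t * B_tilde Q B * mat_adjoint (kern_mat js T t)"
      unfolding sandwich_sandwich[OF DP V B] DPV B_tilde_def sandwich_sandwich[OF K P(1) B] ..
  qed
  finally show "scaled_gramian ?A Q js B T
    = mat_integral n n {0..T} (\<lambda>t. kern_mat js T t * B_tilde Q B * mat_adjoint (kern_mat js T t))" .
qed

section \<open>Limits of the entries\<close>

lemma kern_sandwich_index:
  assumes "K \<in> carrier_mat (sum_list (map fst js)) (sum_list (map fst js))"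
    and i: "i < length js" "a < fst (js ! i)" and j: "j < length js" "b < fst (js ! j)"
  shows "(kern_mat js T t * K * mat_adjoint (kern_mat js T t)) $$ (j_off js i + a, j_off js j + b)
    = (\<Sum>c<fst (js ! i). \<Sum>d<fst (js ! j). K $$ (j_off js i + c, j_off js j + d)
        * (kern_block T t (js ! i) $$ (a, c) * cnj (kern_block T t (js ! j) $$ (b, d))))"
  unfolding kern_mat_def
  by (subst sandwich_block_index[OF kern_block_dims assms(1)]) (use i j in auto)

lemma kern_block_index:
  "a < fst p \<Longrightarrow> c < fst p \<Longrightarrow>
    kern_block T t p $$ (a, c) = (if a \<le> c then kern (snd p) (fst p - Suc a) (c - a) T t else 0)"
  by (simp add: kern_block_def split_def)

lemma kern_block_limit:
  assumes "a < fst p" "b < fst q" and "c < fst p" "d < fst q"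
    and "sgn (Re (snd p)) \<noteq> sgn (Re (snd q)) \<or> Re (snd p) = 0 \<and> snd p \<noteq> snd q"
  shows "((\<lambda>T. integral {0..T} (\<lambda>t. kern_block T t p $$ (a, c) * cnj (kern_block T t q $$ (b, d)))) \<longlongrightarrow> 0) at_top"
  using assms(1-4) kern_limit_0[OF _ _ assms(5), of "c - a" "fst p - Suc a" "d - b" "fst q - Suc b"]
  by (cases "a \<le> c"; cases "b \<le> d") (simp_all add: kern_block_index)

text \<open>In every row the full power of \<open>t\<close> is reached in the last column only. So
  the columns decide whether the limit vanishes, and its value depends on the rows.\<close>

lemma kern_block_limit_imaginary:
  assumes "a < fst p" "b < fst q" and "c < fst p" "d < fst q" and "Re (snd p) = 0" "snd p = snd q"
  shows "((\<lambda>T. integral {0..T} (\<lambda>t. kern_block T t p $$ (a, c) * cnj (kern_block T t q $$ (b, d)))) \<longlongrightarrow>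
    (if c = fst p - 1 \<and> d = fst q - 1 then of_real (C_mat (fst p) (fst q) $$ (a, b)) else 0)) at_top"
proof (cases "a \<le> c \<and> b \<le> d")
  case True
  have iff: "c - a = fst p - Suc a \<and> d - b = fst q - Suc b \<longleftrightarrow> c = fst p - 1 \<and> d = fst q - 1"
    using True assms by auto
  have C: "of_real (C_mat (fst p) (fst q) $$ (a, b))
      = (1 / (fact (fst p - Suc a) * fact (fst q - Suc b) * of_nat (fst p - Suc a + (fst q - Suc b) + 1)) :: complex)"
    using assms by (simp add: C_mat_def)
  show ?thesis
    using True assms kern_limit_imaginary_same[of "snd p" "c - a" "fst p - Suc a" "d - b" "fst q - Suc b"]
    by (simp only: kern_block_index iff C if_True)
next
  case False
  \<comment> \<open>An entry below the diagonal is never in the last column, so its value 0 agrees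
    with the claim.\<close>
  then have "\<not> (c = fst p - 1 \<and> d = fst q - 1)" using assms by auto
  with False assms show ?thesis by (auto simp: kern_block_index)
qed

lemma kern_block_integrable:
  assumes "a < fst p" "b < fst q" and "c < fst p" "d < fst q"
  shows "(\<lambda>t. kern_block T t p $$ (a, c) * cnj (kern_block T t q $$ (b, d))) integrable_on {0..T}"
  using assms by (cases "a \<le> c"; cases "b \<le> d") (simp_all add: kern_block_index integrable_kern_mult integrable_0)

text \<open>Each entry is a finite combination of scalar integrals with coefficients from
  \<open>K\<close>, which depend on neither \<open>t\<close> nor \<open>T\<close>.\<close>

lemma kern_sandwich_integral_limit:
  assumes K: "K \<in> carrier_mat (sum_list (map fst js)) (sum_list (map fst js))"
    and i: "i < length js" "a < fst (js ! i)" and j: "j < length js" "b < fst (js ! j)"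
    and lim: "\<And>c d. c < fst (js ! i) \<Longrightarrow> d < fst (js ! j) \<Longrightarrow> ((\<lambda>T. integral {0..T}
       (\<lambda>t. kern_block T t (js ! i) $$ (a, c) * cnj (kern_block T t (js ! j) $$ (b, d)))) \<longlongrightarrow> L c d) at_top"
  shows "((\<lambda>T. integral {0..T} (\<lambda>t. (kern_mat js T t * K * mat_adjoint (kern_mat js T t))
      $$ (j_off js i + a, j_off js j + b))) \<longlongrightarrow>
    (\<Sum>c<fst (js ! i). \<Sum>d<fst (js ! j). K $$ (j_off js i + c, j_off js j + d) * L c d)) at_top"
proof -
  have "integral {0..T} (\<lambda>t. (kern_mat js T t * K * mat_adjoint (kern_mat js T t))
      $$ (j_off js i + a, j_off js j + b))
    = (\<Sum>c<fst (js ! i). \<Sum>d<fst (js ! j). K $$ (j_off js i + c, j_off js j + d) * integral {0..T}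
       (\<lambda>t. kern_block T t (js ! i) $$ (a, c) * cnj (kern_block T t (js ! j) $$ (b, d))))" for T
    unfolding kern_sandwich_index[OF K i j]
    using i j by (intro integral_unique has_integral_sum has_integral_mult_right integrable_integral
        kern_block_integrable) auto
  then show ?thesis
    using lim by (simp only:) (intro tendsto_intros, auto)
qed

text \<open>\<open>submatrix\<close> selects by rank in an index set; the rank in an interval is the
  distance from its lower end.\<close>

lemma submatrix_interval:
  assumes A: "A \<in> carrier_mat n m" and le: "hi \<le> n" "hi' \<le> m"
  shows "submatrix A {lo..<hi} {lo'..<hi'} \<in> carrier_mat (hi - lo) (hi' - lo')"
    and "\<And>i j. i < hi - lo \<Longrightarrow> j < hi' - lo' \<Longrightarrow> submatrix A {lo..<hi} {lo'..<hi'} $$ (i, j) = A $$ (lo + i, lo' + j)"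
proof -
  have "{i. i < n \<and> i \<in> {lo..<hi}} = {lo..<hi}" "{i. i < m \<and> i \<in> {lo'..<hi'}} = {lo'..<hi'}"
    using le by auto
  then show "submatrix A {lo..<hi} {lo'..<hi'} \<in> carrier_mat (hi - lo) (hi' - lo')"
    using A by (intro carrier_matI) (simp_all add: dim_submatrix)
  fix i j assume ij: "i < hi - lo" "j < hi' - lo'"
  have "{a \<in> {lo..<hi}. a < lo + i} = {lo..<lo + i}" "{a \<in> {lo'..<hi'}. a < lo' + j} = {lo'..<lo' + j}"
    using ij by auto
  then show "submatrix A {lo..<hi} {lo'..<hi'} $$ (i, j) = A $$ (lo + i, lo' + j)"
    using submatrix_index_card[of "lo + i" A "lo' + j" "{lo..<hi}" "{lo'..<hi'}"] ij A le by simp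
qed

text \<open>Applies to a run \<open>vs\<close> of consecutive blocks on which the kernel is an
  unscaled exponential at some time \<open>u\<close>. The stable section has \<open>u = t\<close>,
  the antistable one \<open>u = t - T\<close>.\<close>

lemma kern_sandwich_section:
  fixes us vs ws :: "(nat \<times> complex) list"
  defines "js \<equiv> us @ vs @ ws" and "N \<equiv> sum_list (map fst us)" and "n \<equiv> sum_list (map fst vs)"
  assumes K: "K \<in> carrier_mat (sum_list (map fst js)) (sum_list (map fst js))"
    and kern: "\<And>k l p d. (k, l) \<in> set vs \<Longrightarrow> kern l p d T t = jexp l d u"
    and rs: "r < n" "s < n"
  shows "(kern_mat js T t * K * mat_adjoint (kern_mat js T t)) $$ (N + r, N + s)
    = (jordan_exp vs u * submatrix K {N..<N + n} {N..<N + n} * mat_adjoint (jordan_exp vs u)) $$ (r, s)"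
proof -
  obtain i a where i: "i < length vs" "a < fst (vs ! i)" "r = j_off vs i + a"
    using rs(1) unfolding n_def by (rule block_indexE) simp
  obtain j b where j: "j < length vs" "b < fst (vs ! j)" "s = j_off vs j + b"
    using rs(2) unfolding n_def by (rule block_indexE) simp
  have nth: "js ! (length us + i) = vs ! i" if "i < length vs" for i
    using that by (simp add: js_def nth_append)
  have off: "j_off js (length us + i) = N + j_off vs i" if "i < length vs" for i
    using that by (simp add: js_def N_def block_off_def)
  have block: "kern_block T t (vs ! i) $$ (a, c) = jordan_block_exp (fst (vs ! i)) (snd (vs ! i)) u $$ (a, c)"
    if "i < length vs" "a < fst (vs ! i)" "c < fst (vs ! i)" for i a c
    using that kern[of "fst (vs ! i)" "snd (vs ! i)"] by (simp add: kern_block_index jordan_block_exp_def)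
  have le: "N + n \<le> sum_list (map fst js)" by (simp add: js_def N_def n_def)
  have less: "j_off vs i + c < n" if "i < length vs" "c < fst (vs ! i)" for i c
    unfolding n_def using that by (intro block_index_less_sum_list) auto
  have S: "submatrix K {N..<N + n} {N..<N + n} \<in> carrier_mat (sum_list (map fst vs)) (sum_list (map fst vs))"
    using submatrix_interval(1)[OF K le le, of N N] by (simp add: n_def)
  have "(kern_mat js T t * K * mat_adjoint (kern_mat js T t)) $$ (N + r, N + s)
      = (kern_mat js T t * K * mat_adjoint (kern_mat js T t))
          $$ (j_off js (length us + i) + a, j_off js (length us + j) + b)"
    using i j by (simp add: off add.assoc del: index_mult_mat(1))
  also have "\<dots> = (\<Sum>c<fst (vs ! i). \<Sum>d<fst (vs ! j). K $$ (N + j_off vs i + c, N + j_off vs j + d)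
        * (kern_block T t (vs ! i) $$ (a, c) * cnj (kern_block T t (vs ! j) $$ (b, d))))"
    by (subst kern_sandwich_index[OF K]) (use i j in \<open>auto simp: nth off js_def[symmetric], auto simp: js_def\<close>)
  also have "\<dots> = (\<Sum>c<fst (vs ! i). \<Sum>d<fst (vs ! j).
        submatrix K {N..<N + n} {N..<N + n} $$ (j_off vs i + c, j_off vs j + d)
        * (jordan_block_exp (fst (vs ! i)) (snd (vs ! i)) u $$ (a, c)
           * cnj (jordan_block_exp (fst (vs ! j)) (snd (vs ! j)) u $$ (b, d))))"
    using i j by (intro sum.cong refl) (simp add: block submatrix_interval(2)[OF K le le] less add.assoc)
  also have "\<dots> = (jordan_exp vs u * submatrix K {N..<N + n} {N..<N + n} * mat_adjoint (jordan_exp vs u)) $$ (r, s)"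
    unfolding jordan_exp_def i j
    by (subst sandwich_block_index[OF map_jordan_block_dims(1,2) S])
      (use i j in \<open>auto simp: split_def\<close>)
  finally show ?thesis .
qed

section \<open>Grouping of the Jordan blocks\<close>

lemma m_neg_m_zero_le: "m_neg js + m_zero js \<le> length js"
  by (induction js) (auto simp: m_neg_def m_zero_def)

lemma concat_nth_block:
  assumes "i < length xss" "a < length (xss ! i)"
  shows "concat xss ! (block_off (map length xss) i + a) = xss ! i ! a"
  using assms
proof (induction xss arbitrary: i)
  case (Cons xs xss)
  then show ?case by (cases i) (auto simp: nth_append)
qed simp

text \<open>A sorted list is determined by its multiset. Applied to imaginary parts, this shows that
  equal eigenvalues occupy consecutive positions and that counting them locates each group.\<close>

lemma sorted_eq_concat_replicate:
  fixes xs ds :: "'a::linorder list"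
  assumes "sorted xs" "sorted ds" "distinct ds" "set xs = set ds"
  shows "xs = concat (map (\<lambda>d. replicate (count_list xs d) d) ds)"
proof -
  have sorted: "sorted (concat (map (\<lambda>d. replicate (f d) d) ds))" if "sorted ds" for f :: "'a \<Rightarrow> nat" and ds
    using that by (induction ds) (auto simp: sorted_append sorted_replicate)
  have count: "count (mset (concat (map (\<lambda>d. replicate (f d) d) ds))) x = (if x \<in> set ds then f x else 0)"
    if "distinct ds" for f :: "'a \<Rightarrow> nat" and ds x
    using that by (induction ds) auto
  have "mset (concat (map (\<lambda>d. replicate (count_list xs d) d) ds)) = mset xs"
  proof (rule multiset_eqI)
    fix x
    show "count (mset (concat (map (\<lambda>d. replicate (count_list xs d) d) ds))) x = count (mset xs) x"
      unfolding count[OF assms(3)] assms(4)[symmetric] by (simp add: count_mset)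
  qed
  from properties_for_sort[OF this sorted[OF assms(2)]] show ?thesis
    using assms(1) by (simp add: sorted_sort_id)
qed

text \<open>Injectivity of \<open>f\<close> makes insertions of elements of \<open>A\<close>
  commute, so the fold does not depend on their order. Commutation holds only within
  \<open>A\<close>, hence the induction runs over its subsets.\<close>

lemma sorted_key_list_of_set_properties:
  fixes f :: "'b \<Rightarrow> 'a::linorder"
  assumes A: "finite A" "inj_on f A"
  shows "set (sorted_key_list_of_set f A) = A"
    and "sorted (map f (sorted_key_list_of_set f A))"
    and "distinct (map f (sorted_key_list_of_set f A))"
proof -
  interpret folding_on A "insort_key f" "[]"
  proof
    fix x y assume "x \<in> A" "y \<in> A"
    then have "x = y \<or> f x \<noteq> f y" using A(2) by (auto dest: inj_onD)
    then show "insort_key f y \<circ> insort_key f x = insort_key f x \<circ> insort_key f y"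
      by (auto intro!: insort_key_left_comm)
  qed
  have "set (F B) = B \<and> sorted (map f (F B)) \<and> distinct (map f (F B))" if "finite B" "B \<subseteq> A" for B
    using that
  proof induction
    case (insert x B)
    then have "f x \<notin> f ` B" using A(2) by (auto dest: inj_onD)
    with insert show ?case by (simp add: set_insort_key sorted_insort_key distinct_insort_key)
  qed simp
  from this[OF A(1)] show "set (sorted_key_list_of_set f A) = A"
    and "sorted (map f (sorted_key_list_of_set f A))"
    and "distinct (map f (sorted_key_list_of_set f A))"
    by (auto simp: sorted_key_list_of_set_def)
qed

context
  fixes js :: "(nat \<times> complex) list"
  assumes ord: "jordan_ordered js"
begin

private abbreviation "m1 \<equiv> m_neg js"
private abbreviation "m2 \<equiv> m_neg js + m_zero js"
private abbreviation "ds \<equiv> imag_eigenvalues js"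
private abbreviation "n \<equiv> sum_list (map fst js)"
private abbreviation "N1 \<equiv> j_off js (m_neg js)"
private abbreviation "N2 \<equiv> j_off js (m_neg js + m_zero js)"

lemma ordered_neg: "i < m1 \<Longrightarrow> Re (snd (js ! i)) < 0"
  using ord by (simp add: jordan_ordered_def)

lemma ordered_zero: "m1 \<le> i \<Longrightarrow> i < m2 \<Longrightarrow> Re (snd (js ! i)) = 0"
  using ord by (simp add: jordan_ordered_def)

lemma ordered_pos: "m2 \<le> i \<Longrightarrow> i < length js \<Longrightarrow> 0 < Re (snd (js ! i))"
  using ord by (simp add: jordan_ordered_def)

lemma ordered_Im: "m1 \<le> i \<Longrightarrow> i \<le> j \<Longrightarrow> j < m2 \<Longrightarrow> Im (snd (js ! i)) \<le> Im (snd (js ! j))"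
  using ord by (simp add: jordan_ordered_def)

lemma take_neg: "(k, l) \<in> set (take m1 js) \<Longrightarrow> Re l < 0"
proof -
  assume "(k, l) \<in> set (take m1 js)"
  then obtain i where "i < m1" "js ! i = (k, l)" by (auto simp: in_set_conv_nth)
  then show ?thesis using ordered_neg[of i] by simp
qed

lemma drop_pos: "(k, l) \<in> set (drop m2 js) \<Longrightarrow> 0 < Re l"
proof -
  assume "(k, l) \<in> set (drop m2 js)"
  then obtain i where "i < length js - m2" "js ! (m2 + i) = (k, l)" by (auto simp: in_set_conv_nth)
  then show ?thesis using ordered_pos[of "m2 + i"] by simp
qed

lemma imag_eigenvalues_properties:
  shows "set ds = snd ` set (take (m_zero js) (drop m1 js))" and "sorted (map Im ds)" and "distinct (map Im ds)"
proof -
  let ?S = "(\<lambda>i. snd (js ! i)) ` {m1..<m2}"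
  \<comment> \<open>All elements of \<open>?S\<close> have real part 0, so the imaginary part
    determines them.\<close>
  have inj: "inj_on Im ?S"
    using ordered_zero by (auto intro!: inj_onI simp: complex_eq_iff)
  note * = sorted_key_list_of_set_properties[OF _ inj, folded imag_eigenvalues_def]
  have S: "?S = snd ` set (take (m_zero js) (drop m1 js))"
  proof -
    have "m_zero js \<le> length (drop m1 js)" using m_neg_m_zero_le[of js] by simp
    from nth_image[OF this] have "set (take (m_zero js) (drop m1 js)) = (\<lambda>i. js ! (m1 + i)) ` {0..<m_zero js}"
      using m_neg_m_zero_le[of js] by simp
    also have "\<dots> = (\<lambda>i. js ! i) ` {m1..<m2}"
      using image_image[of "(!) js" "(+) m1" "{0..<m_zero js}"] by (simp add: add.commute)
    finally have "set (take (m_zero js) (drop m1 js)) = (\<lambda>i. js ! i) ` {m1..<m2}" .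
    then show ?thesis by (simp add: image_image)
  qed
  show "set ds = snd ` set (take (m_zero js) (drop m1 js))"
    unfolding S[symmetric] by (rule *) simp
  show "sorted (map Im ds)" "distinct (map Im ds)" by (rule *; simp)+
qed

text \<open>Connects the two descriptions of the imaginary blocks: the ordering only makes imaginary
  parts nondecreasing, whereas \<open>W_zero\<close> finds a group by adding up the multiplicities
  of the earlier ones.\<close>

lemma zero_section:
  defines "cs \<equiv> map (eig_count js) [0..<length ds]"
  shows "sum_list cs = m_zero js"
    and "\<And>l u. l < length ds \<Longrightarrow> u < eig_count js l \<Longrightarrow> snd (js ! (m1 + block_off cs l + u)) = ds ! l"
proof -
  define zs where "zs = take (m_zero js) (drop m1 js)"
  \<comment> \<open>Sorting needs a linear order, so the argument is run on imaginary parts and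
    lifted back through the vanishing real parts.\<close>
  define xs where "xs = map (Im \<circ> snd) zs"
  have len: "length zs = m_zero js" using m_neg_m_zero_le[of js] by (simp add: zs_def)
  have nth: "zs ! i = js ! (m1 + i)" if "i < m_zero js" for i
    using that m_neg_m_zero_le[of js] by (simp add: zs_def)
  have Re_zs: "Re (snd p) = 0" if "p \<in> set zs" for p
    using that ordered_zero len nth by (auto simp: in_set_conv_nth)
  have set_ds: "set ds = snd ` set zs"
    using imag_eigenvalues_properties(1) by (simp add: zs_def)
  have Re_ds: "Re (ds ! l) = 0" if "l < length ds" for l
    using nth_mem[OF that] Re_zs unfolding set_ds by auto
  have "sorted xs"
    unfolding xs_def sorted_iff_nth_mono using ordered_Im len by (auto simp: nth)
  moreover have "set xs = set (map Im ds)"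
    by (simp add: xs_def set_ds image_image)
  ultimately have xs: "xs = concat (map (\<lambda>d. replicate (count_list xs d) d) (map Im ds))"
    using imag_eigenvalues_properties by (intro sorted_eq_concat_replicate)
  have js: "js = take m1 js @ zs @ drop m2 js"
    unfolding zs_def by (metis append_take_drop_id drop_drop add.commute)
  have cnt: "count_list xs (Im (ds ! l)) = eig_count js l" if l: "l < length ds" for l
  proof -
    \<comment> \<open>\<open>eig_count\<close> searches the whole list, but an imaginary eigenvalue
      cannot occur in the stable or antistable section.\<close>
    have "filter (\<lambda>p. snd p = ds ! l) (take m1 js) = []" "filter (\<lambda>p. snd p = ds ! l) (drop m2 js) = []"
      using Re_ds[OF l] take_neg drop_pos by (fastforce simp: filter_empty_conv)+
    then have "filter (\<lambda>p. snd p = ds ! l) js = filter (\<lambda>p. snd p = ds ! l) zs"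
      by (subst js) simp
    also have "\<dots> = filter (\<lambda>p. Im (ds ! l) = Im (snd p)) zs"
      using Re_zs Re_ds[OF l] by (intro filter_cong) (auto simp: complex_eq_iff)
    finally show ?thesis
      by (simp add: eig_count_def xs_def count_list_eq_length_filter filter_map comp_def)
  qed
  let ?xss = "map (\<lambda>d. replicate (count_list xs d) d) (map Im ds)"
  have cs: "map length ?xss = cs"
    unfolding cs_def by (rule nth_equalityI) (auto simp: cnt)
  have "length xs = sum_list cs"
    using arg_cong[OF xs, of length] unfolding length_concat cs .
  then show sum: "sum_list cs = m_zero js" by (simp add: xs_def len)
  fix l u assume l: "l < length ds" and u: "u < eig_count js l"
  have "concat ?xss ! (block_off (map length ?xss) l + u) = ?xss ! l ! u"
    by (rule concat_nth_block) (use l u in \<open>simp_all add: cnt\<close>)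
  then have "xs ! (block_off cs l + u) = ?xss ! l ! u"
    by (simp only: cs xs[symmetric])
  also have "\<dots> = Im (ds ! l)" using l u by (simp add: cnt)
  finally have "xs ! (block_off cs l + u) = Im (ds ! l)" .
  moreover have less: "block_off cs l + u < m_zero js"
    using block_index_less_sum_list[of l cs u] l u unfolding sum by (simp add: cs_def)
  ultimately have "Im (snd (js ! (m1 + block_off cs l + u))) = Im (ds ! l)"
    by (simp add: xs_def len nth add.assoc)
  moreover have "Re (snd (js ! (m1 + block_off cs l + u))) = 0"
    using less by (intro ordered_zero) auto
  ultimately show "snd (js ! (m1 + block_off cs l + u)) = ds ! l"
    using Re_ds[OF l] by (simp add: complex_eq_iff)
qed

lemma block_off_map_upt: "l \<le> m \<Longrightarrow> block_off (map f [0..<m]) l = (\<Sum>k<l. f k)"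
proof (induction l)
  case (Suc l)
  then show ?case by (simp add: block_off_Suc)
qed simp

text \<open>Flattens the two-level block structure: groups of equal eigenvalues, then Jordan blocks
  within a group. Subtracting \<open>N1\<close> accounts for the indices of the stable
  section.\<close>

lemma W_zero_dim_index:
  fixes Q B :: "complex mat"
  shows "dim_row (W_zero Q js B) = N2 - N1" "dim_col (W_zero Q js B) = N2 - N1"
    and "\<And>i j a b. m1 \<le> i \<Longrightarrow> i < m2 \<Longrightarrow> m1 \<le> j \<Longrightarrow> j < m2 \<Longrightarrow> a < fst (js ! i) \<Longrightarrow> b < fst (js ! j) \<Longrightarrow>
      W_zero Q js B $$ (j_off js i + a - N1, j_off js j + b - N1)
      = (if snd (js ! i) = snd (js ! j)
         then b_tilde Q js B i j * of_real (C_mat (fst (js ! i)) (fst (js ! j)) $$ (a, b)) else 0)"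
proof -
  define cs where "cs = map (eig_count js) [0..<length ds]"
  \<comment> \<open>Group \<open>l\<close> starts at the Jordan block \<open>al l\<close>;
    \<open>ks l\<close> lists the block sizes within it, and \<open>Ks\<close> the total sizes of
    the groups.\<close>
  define al where "al l = m1 + block_off cs l" for l
  define ks where "ks l = map (\<lambda>i. fst (js ! i)) [al l..<al (Suc l)]" for l
  define Ks where "Ks = map (\<lambda>l. sum_list (ks l)) [0..<length ds]"
  note zero = zero_section[folded cs_def]
  have len_cs: "length cs = length ds" by (simp add: cs_def)
  have al_Suc: "al (Suc l) = al l + eig_count js l" if "l < length ds" for l
    using that by (simp add: al_def block_off_Suc cs_def)
  have al_le: "al l \<le> m2" for l
    using block_off_le_sum_list[of cs l] by (simp add: al_def zero)
  have al_last: "al (length ds) = m2"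
    using block_off_length[of cs "length ds"] by (simp add: al_def zero len_cs)
  have block: "W_zero_block Q js B l = block_mat (ks l) (\<lambda>i j. b_tilde Q js B (al l + i) (al l + j) \<cdot>\<^sub>m
      map_mat complex_of_real (C_mat (fst (js ! (al l + i))) (fst (js ! (al l + j)))))"
    if "l < length ds" for l
  proof -
    have "m_neg js + (\<Sum>k<l. eig_count js k) = al l"
      using that by (simp add: al_def cs_def block_off_map_upt)
    then show ?thesis
      using al_Suc[OF that] by (simp add: W_zero_block_def Let_def ks_def)
  qed
  have ks: "length (ks l) = eig_count js l" "\<And>u. u < eig_count js l \<Longrightarrow> ks l ! u = fst (js ! (al l + u))"
    if "l < length ds" for l
    using al_Suc[OF that] by (simp_all add: ks_def)
  have off_ks: "j_off js (al l + u) = j_off js (al l) + block_off (ks l) u"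
    if l: "l < length ds" and u: "u \<le> eig_count js l" for l u
  proof -
    have "ks l = take (eig_count js l) (drop (al l) (map fst js))"
      using al_Suc[OF l] al_le[of "Suc l"] m_neg_m_zero_le[of js]
      by (intro nth_equalityI) (auto simp: ks[OF l])
    then have "block_off (ks l) u = block_off (drop (al l) (map fst js)) u"
      using u by (simp add: block_off_take)
    then show ?thesis by (simp add: block_off_add)
  qed
  have off_Ks: "N1 + block_off Ks l = j_off js (al l)" if "l \<le> length ds" for l
    using that
  proof (induction l)
    case 0
    then show ?case by (simp add: al_def)
  next
    case (Suc l)
    then have "j_off js (al (Suc l)) = j_off js (al l) + sum_list (ks l)"
      using off_ks[of l "eig_count js l"] by (simp add: al_Suc block_off_length ks)
    then show ?case using Suc by (simp add: block_off_Suc Ks_def)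
  qed
  have dims: "map dim_row (map (W_zero_block Q js B) [0..<length ds]) = Ks"
    "map dim_col (map (W_zero_block Q js B) [0..<length ds]) = Ks"
    by (auto simp: Ks_def block block_mat_def)
  have "sum_list Ks = N2 - N1"
    using off_Ks[of "length ds"] block_off_length[of Ks "length ds"] by (simp add: al_last Ks_def)
  then show "dim_row (W_zero Q js B) = N2 - N1" "dim_col (W_zero Q js B) = N2 - N1"
    using carrier_matD[OF diag_block_mat_carrier[OF dims]] by (simp_all add: W_zero_def)
  have decomp: "\<exists>l u. l < length ds \<and> u < eig_count js l \<and> i = al l + u" if i: "m1 \<le> i" "i < m2" for i
  proof -
    have "i - m1 < sum_list cs" using i by (simp add: zero)
    then obtain l u where "l < length cs" "u < cs ! l" "i - m1 = block_off cs l + u"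
      by (rule block_indexE)
    then show ?thesis using i by (intro exI[of _ l] exI[of _ u]) (auto simp: al_def cs_def)
  qed
  fix i j a b
  assume i: "m1 \<le> i" "i < m2" and j: "m1 \<le> j" "j < m2" and a: "a < fst (js ! i)" and b: "b < fst (js ! j)"
  obtain l u where lu: "l < length ds" "u < eig_count js l" "i = al l + u" using decomp[OF i] by blast
  obtain l' u' where lu': "l' < length ds" "u' < eig_count js l'" "j = al l' + u'" using decomp[OF j] by blast
  have eig: "snd (js ! i) = ds ! l" "snd (js ! j) = ds ! l'"
    using zero(2) lu lu' by (simp_all add: al_def)
  have "distinct ds" using imag_eigenvalues_properties(3) by (simp add: distinct_map)
  \<comment> \<open>The listed eigenvalues are distinct, so equality of eigenvalues is equality of
    groups.\<close>
  then have same: "snd (js ! i) = snd (js ! j) \<longleftrightarrow> l = l'"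
    unfolding eig using lu lu' by (simp add: nth_eq_iff_index_eq)
  have r: "j_off js i + a - N1 = block_off Ks l + (block_off (ks l) u + a)"
    using off_Ks[of l] off_ks[of l u] lu by simp
  have s: "j_off js j + b - N1 = block_off Ks l' + (block_off (ks l') u' + b)"
    using off_Ks[of l'] off_ks[of l' u'] lu' by simp
  have less: "block_off (ks l) u + a < Ks ! l" "block_off (ks l') u' + b < Ks ! l'"
    using block_index_less_sum_list[of u "ks l" a] block_index_less_sum_list[of u' "ks l'" b] lu lu' a b
    by (simp_all add: ks Ks_def)
  have "W_zero Q js B $$ (j_off js i + a - N1, j_off js j + b - N1)
      = (if l = l' then W_zero_block Q js B l $$ (block_off (ks l) u + a, block_off (ks l') u' + b) else 0)"
    unfolding W_zero_def r s
    by (subst diag_block_mat_index[OF dims]) (use lu lu' less in \<open>auto simp: Ks_def\<close>)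
  also have "\<dots> = (if l = l' then b_tilde Q js B i j * of_real (C_mat (fst (js ! i)) (fst (js ! j)) $$ (a, b)) else 0)"
  proof (cases "l = l'")
    case True
    have C: "dim_row (C_mat p q) = p" "dim_col (C_mat p q) = q" for p q
      by (simp_all add: C_mat_def)
    show ?thesis
      unfolding block[OF lu(1)] using True lu lu' a b
      by (simp add: block_mat_index ks C)
  qed simp
  finally show "W_zero Q js B $$ (j_off js i + a - N1, j_off js j + b - N1)
      = (if snd (js ! i) = snd (js ! j)
         then b_tilde Q js B i j * of_real (C_mat (fst (js ! i)) (fst (js ! j)) $$ (a, b)) else 0)"
    by (simp only: same)
qed

section \<open>Limits of the sections of the Gramian\<close>

lemma N_le: "N1 \<le> N2" "N2 \<le> n"
  by (auto intro: block_off_mono block_off_le_sum_list)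

lemma gramian_limit_neg:
  assumes K: "K \<in> carrier_mat n n"
  defines "W \<equiv> lyap_solution (J_neg js) (submatrix K {0..<N1} {0..<N1})"
  shows "W \<in> carrier_mat N1 N1"
    and "\<And>r s. r < N1 \<Longrightarrow> s < N1 \<Longrightarrow>
      ((\<lambda>T. integral {0..T} (\<lambda>t. (kern_mat js T t * K * mat_adjoint (kern_mat js T t)) $$ (r, s)))
        \<longlongrightarrow> W $$ (r, s)) at_top"
proof -
  let ?vs = "take m1 js"
  have N: "sum_list (map fst ?vs) = N1" by (simp add: block_off_def take_map)
  have S: "submatrix K {0..<N1} {0..<N1} \<in> carrier_mat (sum_list (map fst ?vs)) (sum_list (map fst ?vs))"
    using submatrix_interval(1)[OF K, of N1 N1 0 0] N_le by (simp add: N)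
  have F: "complex_of_real 1 \<cdot>\<^sub>m jordan_matrix ?vs = J_neg js"
    unfolding J_neg_def by (intro eq_matI) auto
  note lyap = jordan_lyap_solution[of 1, OF _ _ S, unfolded F, folded W_def, unfolded N]
  show "W \<in> carrier_mat N1 N1" using lyap(1) take_neg by auto
  fix r s assume rs: "r < N1" "s < N1"
  have "(kern_mat js T t * K * mat_adjoint (kern_mat js T t)) $$ (r, s)
      = (jordan_exp ?vs (1 * t) * submatrix K {0..<N1} {0..<N1} * mat_adjoint (jordan_exp ?vs (1 * t))) $$ (r, s)"
    for T t
    using kern_sandwich_section[of K "[]" ?vs "drop m1 js" T t "1 * t" r s] rs K take_neg
    by (simp add: N kern_def del: index_mult_mat(1))
  then show "((\<lambda>T. integral {0..T} (\<lambda>t. (kern_mat js T t * K * mat_adjoint (kern_mat js T t)) $$ (r, s)))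
        \<longlongrightarrow> W $$ (r, s)) at_top"
    using lyap(2)[OF _ _ rs] take_neg by (simp del: index_mult_mat(1))
qed

lemma gramian_limit_pos:
  assumes K: "K \<in> carrier_mat n n"
  defines "W \<equiv> lyap_solution (- J_pos js) (submatrix K {N2..<n} {N2..<n})"
  shows "W \<in> carrier_mat (n - N2) (n - N2)"
    and "\<And>r s. r < n - N2 \<Longrightarrow> s < n - N2 \<Longrightarrow>
      ((\<lambda>T. integral {0..T} (\<lambda>t. (kern_mat js T t * K * mat_adjoint (kern_mat js T t)) $$ (N2 + r, N2 + s)))
        \<longlongrightarrow> W $$ (r, s)) at_top"
proof -
  let ?vs = "drop m2 js"
  have N2: "sum_list (map fst (take m2 js)) = N2" by (simp add: block_off_def take_map)
  have "n = N2 + sum_list (map fst ?vs)"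
    unfolding N2[symmetric] sum_list_append[symmetric] map_append[symmetric] append_take_drop_id ..
  then have N: "sum_list (map fst ?vs) = n - N2" by simp
  have S: "submatrix K {N2..<n} {N2..<n} \<in> carrier_mat (sum_list (map fst ?vs)) (sum_list (map fst ?vs))"
    using submatrix_interval(1)[OF K, of n n N2 N2] by (simp add: N)
  have F: "complex_of_real (- 1) \<cdot>\<^sub>m jordan_matrix ?vs = - J_pos js"
    unfolding J_pos_def by (intro eq_matI) auto
  note lyap = jordan_lyap_solution[of "- 1", OF _ _ S, unfolded F, folded W_def, unfolded N]
  show "W \<in> carrier_mat (n - N2) (n - N2)" using lyap(1) drop_pos by auto
  fix r s assume rs: "r < n - N2" "s < n - N2"
  let ?f = "\<lambda>t. (jordan_exp ?vs t * submatrix K {N2..<n} {N2..<n} * mat_adjoint (jordan_exp ?vs t)) $$ (r, s)"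
  have "kern l p d T t = jexp l d (t - T)" if "(k, l) \<in> set ?vs" for k l p d T t
    using drop_pos[OF that] by (simp add: kern_def)
  then have "(kern_mat js T t * K * mat_adjoint (kern_mat js T t)) $$ (N2 + r, N2 + s) = ?f (t - T)" for T t
    using kern_sandwich_section[of K "take m2 js" ?vs "[]" T t "t - T" r s] rs K N_le
    by (simp add: N N2 del: index_mult_mat(1))
  \<comment> \<open>The reflected integrand no longer contains \<open>T\<close>, so the limit is the
    improper integral for the time direction \<open>- 1\<close>.\<close>
  moreover have "integral {0..T} (\<lambda>t. ?f (t - T)) = integral {0..T} (\<lambda>t. ?f (- 1 * t))" for T
    using integral_reflect_interval[of T ?f] by (simp del: index_mult_mat(1))
  ultimately show "((\<lambda>T. integral {0..T} (\<lambda>t. (kern_mat js T t * K * mat_adjoint (kern_mat js T t)) $$ (N2 + r, N2 + s)))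
        \<longlongrightarrow> W $$ (r, s)) at_top"
    using lyap(2)[OF _ _ rs] drop_pos by (simp only:) auto
qed

text \<open>Of the double sum over the columns of two blocks only the term with both last columns
  can survive. Its coefficient is the lower-right entry \<open>b_tilde\<close>, and its scalar limit
  is the entry of \<open>C_mat\<close>.\<close>

lemma gramian_limit_zero:
  assumes K: "B_tilde Q B \<in> carrier_mat n n"
    and i: "m1 \<le> i" "i < m2" "a < fst (js ! i)" and j: "m1 \<le> j" "j < m2" "b < fst (js ! j)"
  shows "((\<lambda>T. integral {0..T} (\<lambda>t. (kern_mat js T t * B_tilde Q B * mat_adjoint (kern_mat js T t))
      $$ (j_off js i + a, j_off js j + b)))
    \<longlongrightarrow> W_zero Q js B $$ (j_off js i + a - N1, j_off js j + b - N1)) at_top"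
proof -
  let ?K = "B_tilde Q B" and ?k = "fst (js ! i)" and ?k' = "fst (js ! j)"
  let ?L = "\<lambda>c d. if snd (js ! i) = snd (js ! j) \<and> c = ?k - 1 \<and> d = ?k' - 1
    then complex_of_real (C_mat ?k ?k' $$ (a, b)) else 0"
  have len: "i < length js" "j < length js" using i j m_neg_m_zero_le[of js] by auto
  have off: "j_off js (Suc x) = j_off js x + fst (js ! x)" if "x < length js" for x
    using that by (simp add: block_off_Suc)
  have le: "j_off js (Suc x) \<le> n" for x by (rule block_off_le_sum_list)
  have bt: "b_tilde Q js B i j = ?K $$ (j_off js i + (?k - 1), j_off js j + (?k' - 1))"
    unfolding b_tilde_def using i j len
    by (subst submatrix_interval(2)[OF K le le]) (auto simp: off)
  have "((\<lambda>T. integral {0..T}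
       (\<lambda>t. kern_block T t (js ! i) $$ (a, c) * cnj (kern_block T t (js ! j) $$ (b, d)))) \<longlongrightarrow> ?L c d) at_top"
    if cd: "c < ?k" "d < ?k'" for c d
  proof (cases "snd (js ! i) = snd (js ! j)")
    case True
    then show ?thesis
      using kern_block_limit_imaginary[OF i(3) j(3) cd ordered_zero[OF i(1,2)] True] by simp
  next
    case False
    then show ?thesis
      using kern_block_limit[OF i(3) j(3) cd] ordered_zero[OF i(1,2)] by simp
  qed
  from kern_sandwich_integral_limit[OF K len(1) i(3) len(2) j(3) this]
  have "((\<lambda>T. integral {0..T} (\<lambda>t. (kern_mat js T t * ?K * mat_adjoint (kern_mat js T t))
      $$ (j_off js i + a, j_off js j + b)))
    \<longlongrightarrow> (\<Sum>c<?k. \<Sum>d<?k'. ?K $$ (j_off js i + c, j_off js j + d) * ?L c d)) at_top" .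
  also have "(\<Sum>c<?k. \<Sum>d<?k'. ?K $$ (j_off js i + c, j_off js j + d) * ?L c d)
      = W_zero Q js B $$ (j_off js i + a - N1, j_off js j + b - N1)" (is "_ = ?w")
  proof -
    have w: "?w = (if snd (js ! i) = snd (js ! j)
        then b_tilde Q js B i j * of_real (C_mat ?k ?k' $$ (a, b)) else 0)"
      using i j by (intro W_zero_dim_index(3))
    have "?K $$ (j_off js i + c, j_off js j + d) * ?L c d
        = (if d = ?k' - 1 then (if c = ?k - 1 then ?w else 0) else 0)" for c d
      by (auto simp: w bt)
    then have "(\<Sum>c<?k. \<Sum>d<?k'. ?K $$ (j_off js i + c, j_off js j + d) * ?L c d)
        = (\<Sum>c<?k. if c = ?k - 1 then ?w else 0)"
      using j by simp
    \<comment> \<open>The index \<open>?k - 1\<close> lies in the range of summation because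
      \<open>a < ?k\<close> makes the block nonempty.\<close>
    also have "\<dots> = ?w" using i by simp
    finally show ?thesis .
  qed
  finally show ?thesis .
qed

lemma gramian_limit_mixed:
  assumes K: "K \<in> carrier_mat n n"
    and i: "i < length js" "a < fst (js ! i)" and j: "j < length js" "b < fst (js ! j)"
    and "sgn (Re (snd (js ! i))) \<noteq> sgn (Re (snd (js ! j)))"
  shows "((\<lambda>T. integral {0..T} (\<lambda>t. (kern_mat js T t * K * mat_adjoint (kern_mat js T t))
      $$ (j_off js i + a, j_off js j + b))) \<longlongrightarrow> 0) at_top"
proof -
  have "((\<lambda>T. integral {0..T}
       (\<lambda>t. kern_block T t (js ! i) $$ (a, c) * cnj (kern_block T t (js ! j) $$ (b, d)))) \<longlongrightarrow> 0) at_top"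
    if "c < fst (js ! i)" "d < fst (js ! j)" for c d
    using kern_block_limit[OF i(2) j(2) that] assms(6) by blast
  from kern_sandwich_integral_limit[OF K i j this] show ?thesis by simp
qed

lemma W_infinity_limit:
  assumes K: "B_tilde Q B \<in> carrier_mat n n"
  shows "W_infinity Q js B \<in> carrier_mat n n"
    and "\<And>r s. r < n \<Longrightarrow> s < n \<Longrightarrow>
      ((\<lambda>T. integral {0..T} (\<lambda>t. (kern_mat js T t * B_tilde Q B * mat_adjoint (kern_mat js T t)) $$ (r, s)))
        \<longlongrightarrow> W_infinity Q js B $$ (r, s)) at_top"
proof -
  let ?Ws = "[W_neg Q js B, W_zero Q js B, W_pos Q js B]" and ?ks = "[N1, N2 - N1, n - N2]"
  have n: "j_off js (length js) = n" by (simp add: block_off_length)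
  have Wn: "W_neg Q js B = lyap_solution (J_neg js) (submatrix (B_tilde Q B) {0..<N1} {0..<N1})"
    by (simp add: W_neg_def Let_def)
  have Wp: "W_pos Q js B = lyap_solution (- J_pos js) (submatrix (B_tilde Q B) {N2..<n} {N2..<n})"
    by (simp add: W_pos_def Let_def n)
  note neg = gramian_limit_neg[OF K, folded Wn] and pos = gramian_limit_pos[OF K, folded Wp]
  have dims: "map dim_row ?Ws = ?ks" "map dim_col ?Ws = ?ks"
    using neg(1) pos(1) W_zero_dim_index(1,2) by auto
  have sum: "sum_list ?ks = n" using N_le by simp
  show "W_infinity Q js B \<in> carrier_mat n n"
    using diag_block_mat_carrier[OF dims] unfolding W_infinity_def sum .
  fix r s assume r: "r < n" and s: "s < n"
  obtain i a where i: "i < length js" "a < fst (js ! i)" "r = j_off js i + a"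
    using r by (rule block_indexE) simp
  obtain j b where j: "j < length js" "b < fst (js ! j)" "s = j_off js j + b"
    using s by (rule block_indexE) simp
  \<comment> \<open>The section containing block \<open>x\<close>: 0 for stable, 1 for imaginary, 2
    for antistable.\<close>
  define g where "g x = (if x < m1 then 0 else if x < m2 then 1 else 2 :: nat)" for x
  have g: "g x < 3" "block_off ?ks (g x) \<le> j_off js x + c" "j_off js x + c - block_off ?ks (g x) < ?ks ! g x"
    if x: "x < length js" "c < fst (js ! x)" for x c
  proof -
    have off: "block_off ?ks (Suc 0) = N1" "block_off ?ks 2 = N2"
      using N_le by (simp_all add: block_off_def numeral_2_eq_2)
    consider "x < m1" | "m1 \<le> x" "x < m2" | "m2 \<le> x" by linarith
    then have "g x < 3 \<and> block_off ?ks (g x) \<le> j_off js x + c \<and> j_off js x + c - block_off ?ks (g x) < ?ks ! g x"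
    proof cases
      case 1
      then show ?thesis
        using block_index_less[of x m1 "map fst js" c] m_neg_m_zero_le[of js] x by (simp add: g_def)
    next
      case 2
      then show ?thesis
        using block_index_less[of x m2 "map fst js" c] block_off_mono[of m1 x "map fst js"] m_neg_m_zero_le[of js] x
        by (simp add: g_def off)
    next
      case 3
      then show ?thesis
        using block_index_less[of x "length js" "map fst js" c] block_off_mono[of m2 x "map fst js"] x
        by (simp add: g_def off n)
    qed
    then show "g x < 3" "block_off ?ks (g x) \<le> j_off js x + c" "j_off js x + c - block_off ?ks (g x) < ?ks ! g x"
      by auto
  qed
  have W: "W_infinity Q js B $$ (r, s) = (if g i = g j then
      (?Ws ! g i) $$ (r - block_off ?ks (g i), s - block_off ?ks (g j)) else 0)"
    using diag_block_mat_index[OF dims, of "g i" "r - block_off ?ks (g i)" "g j" "s - block_off ?ks (g j)"]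
      g[OF i(1,2)] g[OF j(1,2)] i(3) j(3) unfolding W_infinity_def by simp
  show "((\<lambda>T. integral {0..T} (\<lambda>t. (kern_mat js T t * B_tilde Q B * mat_adjoint (kern_mat js T t)) $$ (r, s)))
        \<longlongrightarrow> W_infinity Q js B $$ (r, s)) at_top"
  proof (cases "g i = g j")
    case False
    have "sgn (Re (snd (js ! i))) \<noteq> sgn (Re (snd (js ! j)))"
    proof -
      \<comment> \<open>The section number is the sign of the real part shifted by one, so different
        sections have different signs.\<close>
      have "sgn (Re (snd (js ! x))) = real (g x) - 1" if "x < length js" for x
        using that ordered_neg[of x] ordered_zero[of x] ordered_pos[of x] by (auto simp: g_def sgn_if)
      then show ?thesis using False i j by auto
    qed
    then show ?thesis
      using gramian_limit_mixed[OF K i(1,2) j(1,2), folded i(3) j(3)] False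
      by (simp add: W del: index_mult_mat(1))
  next
    case True
    consider "i < m1" "j < m1" | "m1 \<le> i" "i < m2" "m1 \<le> j" "j < m2" | "m2 \<le> i" "m2 \<le> j"
      using True by (auto simp: g_def split: if_splits)
    then show ?thesis
    proof cases
      case 1
      then have "r < N1" "s < N1" using g[OF i(1,2)] g[OF j(1,2)] i(3) j(3) by (auto simp: g_def)
      with neg(2) show ?thesis using True 1 by (simp add: W g_def del: index_mult_mat(1))
    next
      case 2
      have "block_off ?ks (Suc 0) = N1" by (simp add: block_off_def)
      then show ?thesis
        using gramian_limit_zero[OF K 2(1,2) i(2) 2(3,4) j(2), folded i(3) j(3)] True 2
        by (simp add: W g_def del: index_mult_mat(1))
    next
      case 3
      have off: "block_off ?ks 2 = N2" using N_le by (simp add: block_off_def numeral_2_eq_2)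
      have "N2 \<le> r" "N2 \<le> s" "r - N2 < n - N2" "s - N2 < n - N2"
        using g[OF i(1,2)] g[OF j(1,2)] i(3) j(3) 3 off by (auto simp: g_def)
      then show ?thesis
        using pos(2)[of "r - N2" "s - N2"] True 3 off
        by (simp add: W g_def numeral_2_eq_2 del: index_mult_mat(1))
    qed
  qed
qed

end

theorem theorem1:
  fixes n :: nat
    and A :: "real mat"
    and Q B :: "complex mat"
    and js :: "(nat \<times> complex) list"
  assumes "A \<in> carrier_mat n n"
    and "B \<in> carrier_mat n n"
    and "Q \<in> carrier_mat n n"
    and "invertible_mat Q"
    and "mat_inv Q * map_mat complex_of_real A * Q = jordan_matrix js"
    and "jordan_ordered js"
  shows "mat_tendsto (scaled_gramian (map_mat complex_of_real A) Q js B)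
           (W_infinity Q js B) at_top"
proof -
  let ?F = "\<lambda>T t. kern_mat js T t * B_tilde Q B * mat_adjoint (kern_mat js T t)"
  have G: "scaled_gramian (map_mat complex_of_real A) Q js B T = mat_integral n n {0..T} (?F T)" if "0 < T" for T
    using scaled_gramian_eq(1)[OF assms that] .
  \<comment> \<open>These two facts do not mention \<open>T\<close>; the value 1 merely provides a
    positive time.\<close>
  have n: "sum_list (map fst js) = n" and K: "B_tilde Q B \<in> carrier_mat n n"
    using scaled_gramian_eq(2,3)[OF assms, of 1] by auto
  note W = W_infinity_limit[OF assms(6), of Q B, unfolded n, OF K]
  have "\<forall>\<^sub>F T in at_top. scaled_gramian (map_mat complex_of_real A) Q js B T \<in> carrier_mat n n"
    using eventually_gt_at_top[of 0] by eventually_elim (simp add: G mat_integral_def)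
  moreover have "((\<lambda>T. scaled_gramian (map_mat complex_of_real A) Q js B T $$ (r, s))
      \<longlongrightarrow> W_infinity Q js B $$ (r, s)) at_top" if rs: "r < n" "s < n" for r s
  proof (rule Lim_transform_eventually[OF W(2)[OF rs]])
    show "\<forall>\<^sub>F T in at_top. integral {0..T} (\<lambda>t. ?F T t $$ (r, s))
        = scaled_gramian (map_mat complex_of_real A) Q js B T $$ (r, s)"
      using eventually_gt_at_top[of 0]
      by eventually_elim (simp add: G mat_integral_def rs del: index_mult_mat(1))
  qed
  ultimately show ?thesis
    using W(1) by (auto simp: mat_tendsto_def)
qed

end
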